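(* For every $n\in\mathbb{N}=\{0,1,2,\dots\}$ and every $n$-dimensional cubical complex $\mathcal{L}$, $$h(\mathrm{sd}(\mathcal{L}),x)\;=\;\sum_{k=0}^{n+1}h_k(\mathcal{L})\,p^B_{n,k}(x),$$ where $(h_0(\mathcal{L}),h_1(\mathcal{L}),\dots,h_{n+1}(\mathcal{L}))$ is the normalized cubical $h$-vector of $\mathcal{L}$, $\mathrm{sd}(\mathcal{L})$ is the barycentric subdivision of $\mathcal{L}$, $h(\mathrm{sd}(\mathcal{L}),x)$ is its (simplicial) $h$-polynomial, and the polynomials $p^B_{n,k}(x)$ are those defined in the context.
   Context: All complexes are finite. **Cubical complexes.** A regular cell complex is a finite collection $\mathcal{L}$ of subspaces of a Hausdorff space $X$, called cells or faces, each (nonempty one) homeomorphic to a closed unit ball in some finite-dimensional Euclidean space, such that: (a) $\varnothing\in\mathcal{L}$; (b) the relative interiors of the nonempty cells partition $X$; (c) the boundary of any cell in $\mathcal{L}$ is a union of cells in $\mathcal{L}$. Its dimension is the maximum dimension of its cells. A cubical complex is a regular cell complex each of whose nonempty faces is combinatorially isomorphic to a cube. **Cubical $h$-vector.** For an $n$-dimensional cubical complex $\mathcal{L}$, let $f_k(\mathcal{L})$ be the number of its $k$-dimensional faces and $\widetilde{\chi}(\mathcal{L})=-1+\sum_{k=0}^n(-1)^kf_k(\mathcal{L})$. The normalized cubical $h$-polynomial $h(\mathcal{L},x)$ is defined by $$(1+x)\,h(\mathcal{L},x)=1+\sum_{k=0}^nf_k(\mathcal{L})\,x^{k+1}\left(\frac{1-x}{2}\right)^{n-k}+(-1)^n\widetilde{\chi}(\mathcal{L})\,x^{n+2};$$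 it is a polynomial in $x$ of degree at most $n+1$. The normalized cubical $h$-vector is $(h_0(\mathcal{L}),\dots,h_{n+1}(\mathcal{L}))$, where $h(\mathcal{L},x)=\sum_{k=0}^{n+1}h_k(\mathcal{L})x^k$. **Barycentric subdivision.** $\mathrm{sd}(\mathcal{L})$ is the abstract simplicial complex whose faces are the chains $\sigma_0\subset\sigma_1\subset\cdots\subset\sigma_k$ of nonempty faces of $\mathcal{L}$ (including the empty chain). The barycentric subdivision of the $n$-dimensional cube is that of the complex of all its faces (including the cube itself). **Simplicial $h$-polynomials.** A relative simplicial complex $\Delta/\Gamma$ of dimension $n$ is a pair consisting of an $n$-dimensional abstract simplicial complex $\Delta$ and a subcomplex $\Gamma$; its faces are those of $\Delta$ not in $\Gamma$. Its $h$-polynomial is $h(\Delta/\Gamma,x)=\sum_{F\in\Delta\smallsetminus\Gamma}x^{|F|}(1-x)^{n+1-|F|}$. When $\Gamma$ is empty (has no faces at all), this is $h(\Delta,x)$, in which the empty face of $\Delta$ is included. **The polynomials $p^B_{n,k}(x)$.** For $n\in\mathbb{N}$ and $k\in\{0,1,\dots,n+1\}$, $\mathcal{C}_{n,k}$ is the relative simplicial complex obtained from the barycentric subdivision of the $n$-dimensional cube by removing: no face, if $k=0$; all faces (including the empty face) which lie in one facet and $k-1$ pairs of antipodal facets of the cube (that is, all faces contained in at least one of these $2k-1$ distinct facets), if $k\in\{1,\dots,n\}$; all faces on the boundary of the cube (including the empty face), if $k=n+1$. Then $p^B_{n,k}(x)=h(\mathcal{C}_{n,k},x)$ for $k\in\{0,n+1\}$,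 and $p^B_{n,k}(x)=2h(\mathcal{C}_{n,k},x)$ for $k\in\{1,\dots,n\}$. *)

theory Defs
  imports "HOL-Analysis.Analysis" "HOL-Computational_Algebra.Polynomial"
begin

definition closed_unit_ball :: "nat \<Rightarrow> (nat \<Rightarrow> real) topology" where
  "closed_unit_ball d = subtopology (Euclidean_space d) {x. (\<Sum>i<d. (x i)\<^sup>2) \<le> 1}"

definition ball_like :: "'a topology \<Rightarrow> 'a set \<Rightarrow> nat \<Rightarrow> bool" where
  "ball_like X \<sigma> d \<longleftrightarrow>
     \<sigma> \<subseteq> topspace X \<and> subtopology X \<sigma> homeomorphic_space closed_unit_ball d"

text \<open>By invariance of domain the number \<open>d\<close> below is unique whenever it exists, and the
  relative interior of a cell does not depend on the chosen homeomorphism with a ball. Both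
  notions are meaningful only for nonempty cells; the relative interior of the empty set is empty.\<close>

definition cell_dim :: "'a topology \<Rightarrow> 'a set \<Rightarrow> nat" where
  "cell_dim X \<sigma> = (THE d. ball_like X \<sigma> d)"

definition cell_interior :: "'a topology \<Rightarrow> 'a set \<Rightarrow> 'a set" where
  "cell_interior X \<sigma> =
     {f x | f x d. homeomorphic_map (closed_unit_ball d) (subtopology X \<sigma>) f \<and>
                   x \<in> topspace (closed_unit_ball d) \<and> (\<Sum>i<d. (x i)\<^sup>2) < 1}"

definition cell_boundary :: "'a topology \<Rightarrow> 'a set \<Rightarrow> 'a set" where
  "cell_boundary X \<sigma> = \<sigma> - cell_interior X \<sigma>"

definition regular_cell_complex :: "'a topology \<Rightarrow> 'a set set \<Rightarrow> bool" where
  "regular_cell_complex X L \<longleftrightarrow>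
     Hausdorff_space X \<and> finite L \<and>
     (\<forall>\<sigma>\<in>L - {{}}. \<exists>d. ball_like X \<sigma> d) \<and>
     {} \<in> L \<and>
     (\<Union>\<sigma>\<in>L - {{}}. cell_interior X \<sigma>) = topspace X \<and>
     disjoint_family_on (cell_interior X) (L - {{}}) \<and>
     (\<forall>\<sigma>\<in>L. \<exists>K\<subseteq>L. cell_boundary X \<sigma> = \<Union>K)"

text \<open>The maximum is over a nonempty set only if the complex has a nonempty cell; the complex
  \<open>{{}}\<close>, of dimension \<open>-1\<close>, has to be excluded where this is used.\<close>

definition complex_dim :: "'a topology \<Rightarrow> 'a set set \<Rightarrow> nat" where
  "complex_dim X L = Max (cell_dim X ` (L - {{}}))"

text \<open>The standard cube \<open>[0,1]\<^sup>d\<close>: its nonempty faces are the products of \<open>d\<close> factors, each of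
  them \<open>{0}\<close>, \<open>{1}\<close> or \<open>[0,1]\<close>. For \<open>d = 0\<close> the cube is a single point.\<close>

definition cube_faces :: "nat \<Rightarrow> (nat \<Rightarrow> real) set set" where
  "cube_faces d = {PiE {..<d} s | s. \<forall>i<d. s i \<in> {{0}, {1}, {0..1}}}"

definition inclusion_isomorphic :: "'a set set \<Rightarrow> 'b set set \<Rightarrow> bool" where
  "inclusion_isomorphic P Q \<longleftrightarrow>
     (\<exists>\<phi>. bij_betw \<phi> P Q \<and> (\<forall>\<sigma>\<in>P. \<forall>\<tau>\<in>P. \<sigma> \<subseteq> \<tau> \<longleftrightarrow> \<phi> \<sigma> \<subseteq> \<phi> \<tau>))"

definition cubical_complex :: "'a topology \<Rightarrow> 'a set set \<Rightarrow> bool" where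
  "cubical_complex X L \<longleftrightarrow>
     regular_cell_complex X L \<and>
     (\<forall>\<sigma>\<in>L - {{}}. \<exists>d. inclusion_isomorphic {\<tau>\<in>L. \<tau> \<subseteq> \<sigma>} (insert {} (cube_faces d)))"

definition f_num :: "'a topology \<Rightarrow> 'a set set \<Rightarrow> nat \<Rightarrow> nat" where
  "f_num X L k = card {\<sigma>\<in>L - {{}}. cell_dim X \<sigma> = k}"

definition reduced_euler :: "'a topology \<Rightarrow> 'a set set \<Rightarrow> int" where
  "reduced_euler X L = - 1 + (\<Sum>k=0..complex_dim X L. (- 1) ^ k * int (f_num X L k))"

definition cubical_h_numerator :: "'a topology \<Rightarrow> 'a set set \<Rightarrow> real poly" where
  "cubical_h_numerator X L = (let n = complex_dim X L in
     1 + (\<Sum>k=0..n. smult (real (f_num X L k)) (monom 1 (k + 1) * [:1/2, - 1/2:] ^ (n - k)))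
       + monom ((- 1) ^ n * of_int (reduced_euler X L)) (n + 2))"

definition cubical_h_poly :: "'a topology \<Rightarrow> 'a set set \<Rightarrow> real poly" where
  "cubical_h_poly X L = (THE h. [:1, 1:] * h = cubical_h_numerator X L)"

definition cubical_h :: "'a topology \<Rightarrow> 'a set set \<Rightarrow> nat \<Rightarrow> real" where
  "cubical_h X L k = coeff (cubical_h_poly X L) k"

lemma cubical_h_poly_eq: "[:1, 1:] * cubical_h_poly X L = cubical_h_numerator X L"
proof -
  define n where "n = complex_dim X L"
  have half: "poly [:1/2, - 1/2:] (- 1 :: real) = 1" by simp
  have "poly (cubical_h_numerator X L) (- 1) =
      1 + (\<Sum>k=0..n. real (f_num X L k) * (- 1) ^ (k + 1))
        + (- 1) ^ n * of_int (reduced_euler X L) * (- 1) ^ (n + 2)"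
    unfolding cubical_h_numerator_def Let_def n_def[symmetric]
    by (simp only: poly_add poly_sum poly_smult poly_mult poly_power poly_monom half) simp
  also have "\<dots> = 1 - (\<Sum>k=0..n. (- 1) ^ k * real (f_num X L k)) + of_int (reduced_euler X L)"
    by (simp add: sum_negf mult.commute mult.assoc flip: power_add)
  also have "\<dots> = 0"
    by (simp add: reduced_euler_def n_def)
  finally have "[:1, 1:] dvd cubical_h_numerator X L"
    using poly_eq_0_iff_dvd[of "cubical_h_numerator X L" "- 1"] by simp
  then obtain h where h: "[:1, 1:] * h = cubical_h_numerator X L"
    by (metis dvdE)
  have "\<exists>!h. [:1, 1:] * h = cubical_h_numerator X L"
  proof (rule ex1I[of _ h])
    fix g assume "[:1, 1:] * g = cubical_h_numerator X L"
    then have "[:1, 1:] * g = [:1, 1:] * h" using h by simp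
    then show "g = h" by (metis mult_left_cancel one_neq_zero pCons_eq_0_iff)
  qed (rule h)
  then show ?thesis
    unfolding cubical_h_poly_def by (rule theI')
qed

definition sd :: "'a set set \<Rightarrow> 'a set set set" where
  "sd L = {C. C \<subseteq> L - {{}} \<and> (\<forall>\<sigma>\<in>C. \<forall>\<tau>\<in>C. \<sigma> \<subseteq> \<tau> \<or> \<tau> \<subseteq> \<sigma>)}"

text \<open>The \<open>h\<close>-polynomial of \<open>\<Delta>/\<Gamma>\<close>. Here \<open>r\<close> is the maximal cardinality of a face of \<open>\<Delta>\<close>,
  that is, one more than the dimension of \<open>\<Delta>\<close>.\<close>

definition h_poly :: "'v set set \<Rightarrow> 'v set set \<Rightarrow> real poly" where
  "h_poly \<Delta> \<Gamma> = (let r = Max (card ` \<Delta>) in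
     \<Sum>F\<in>\<Delta> - \<Gamma>. monom 1 (card F) * [:1, - 1:] ^ (r - card F))"

definition cube_facet :: "nat \<Rightarrow> nat \<Rightarrow> real \<Rightarrow> (nat \<Rightarrow> real) set" where
  "cube_facet n i a = {x \<in> PiE {..<n} (\<lambda>_. {0..1}). x i = a}"

definition cube_boundary :: "nat \<Rightarrow> (nat \<Rightarrow> real) set" where
  "cube_boundary n = (\<Union>i<n. \<Union>a\<in>{0, 1}. cube_facet n i a)"

text \<open>The \<open>2k - 1\<close> facets used for \<open>1 \<le> k \<le> n\<close>: the antipodal pairs in the first \<open>k - 1\<close>
  coordinate directions and one facet in the next direction. The symmetries of the cube act
  transitively on all such choices, so another choice gives an isomorphic relative complex.\<close>

definition removed_facets :: "nat \<Rightarrow> nat \<Rightarrow> (nat \<Rightarrow> real) set set" where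
  "removed_facets n k =
     {cube_facet n i a | i a. i < k - 1 \<and> a \<in> {0, 1}} \<union> {cube_facet n (k - 1) 0}"

text \<open>The subcomplex removed in \<open>\<C>\<^sub>n\<^sub>,\<^sub>k\<close>. The simplex of the subdivision spanned by the
  barycenters of a chain of faces lies in a given facet, or on the boundary of the cube, if and
  only if all faces in the chain do. In particular the empty chain is removed for all \<open>k \<ge> 1\<close>,
  also for \<open>n = 0\<close>, where the boundary is empty.\<close>

definition removed_part :: "nat \<Rightarrow> nat \<Rightarrow> (nat \<Rightarrow> real) set set set" where
  "removed_part n k =
     (if k = 0 then {}
      else if k \<le> n then {C \<in> sd (cube_faces n). \<exists>G\<in>removed_facets n k. \<forall>F\<in>C. F \<subseteq> G}
      else {C \<in> sd (cube_faces n). \<forall>F\<in>C. F \<subseteq> cube_boundary n})"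

definition pB :: "nat \<Rightarrow> nat \<Rightarrow> real poly" where
  "pB n k = (let h = h_poly (sd (cube_faces n)) (removed_part n k) in
     if 1 \<le> k \<and> k \<le> n then smult 2 h else h)"

end

theory Submission
  imports "HOL-Homology.Invariance_of_Domain" Defs
begin

text \<open>Both sides of the identity depend only on numbers of faces. Group the nonempty chains of faces
  of a cubical complex \<open>L\<close> by their largest face. The faces below a face of dimension \<open>j\<close> form the
  face poset of the \<open>j\<close>-cube, so the contribution of a largest face to the \<open>h\<close>-polynomial is a
  polynomial \<open>B j\<close> that depends on \<open>j\<close> and \<open>n\<close> only (\<open>top_chain_sum\<close>). Hence
  \<open>h(sd L) = (1 - x)^(n+1) + \<Phi>(f)\<close>, where \<open>f(y) = \<Sum>k. f_k y^k\<close> is the face polynomial of \<open>L\<close> and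
  \<open>\<Phi>\<close> is the linear map with \<open>\<Phi>(y^j) = B j\<close> (\<open>subdivided\<close>).

  The same argument applies to the relative complexes that define the polynomials on the right-hand
  side: a chain of faces of the \<open>n\<close>-cube survives if and only if its largest face does. A face is a
  choice of one of \<open>{0}\<close>, \<open>{1}\<close>, \<open>[0,1]\<close> in every coordinate, and \<open>[0,1]\<close> contributes a factor
  \<open>y\<close>; therefore the face polynomial of the surviving faces is a product over the coordinates, namely
  \<open>(2 + y)^n\<close> for \<open>k = 0\<close>, then \<open>y^(k-1) (1 + y) (2 + y)^(n-k)\<close> for \<open>1 \<le> k \<le> n\<close>, and \<open>y^n\<close> for
  \<open>k = n + 1\<close> (\<open>pB_0\<close>, \<open>pB_middle\<close>, \<open>pB_top\<close>). By linearity of \<open>\<Phi>\<close> it suffices to know that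
  \<open>f(y) = (2 + y)^n + \<Sum>k=1..n. 2 h_k y^(k-1) (1 + y) (2 + y)^(n-k) + h_(n+1) y^n\<close>
  (\<open>f_polynomial_eq\<close>). This is the defining equation of the cubical \<open>h\<close>-polynomial after the
  substitution \<open>x = y / (2 + y)\<close>, for which \<open>(1 - x) / 2 = 1 / (2 + y)\<close>; it uses \<open>h_0 = 1\<close> and that
  \<open>h_(n+1)\<close> is the signed reduced Euler characteristic.

  One point is topological. The numbers \<open>f_k\<close> count cells by the dimension of the ball to which they
  are homeomorphic, whereas the chains see only the cube to whose face poset a cell is isomorphic.
  The two dimensions agree because in a regular cell complex a proper face has smaller dimension, and
  a cell of dimension \<open>D + 1\<close> has a face of dimension \<open>D\<close>; both facts follow from invariance of
  domain (\<open>cell_dim_strict_mono\<close>, \<open>cell_has_facet\<close>, \<open>cell_dim_cubical\<close>).\<close>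

section \<open>Balls in Euclidean space\<close>

definition open_unit_ball :: "nat \<Rightarrow> (nat \<Rightarrow> real) set" where
  "open_unit_ball d = {x \<in> topspace (Euclidean_space d). (\<Sum>i<d. (x i)\<^sup>2) < 1}"

lemma topspace_closed_unit_ball:
  "topspace (closed_unit_ball d) = {x \<in> topspace (Euclidean_space d). (\<Sum>i<d. (x i)\<^sup>2) \<le> 1}"
  by (auto simp: closed_unit_ball_def)

lemma open_unit_ball_subset: "open_unit_ball d \<subseteq> topspace (closed_unit_ball d)"
  by (auto simp: open_unit_ball_def topspace_closed_unit_ball)

lemma zero_in_open_unit_ball: "(\<lambda>i. 0) \<in> open_unit_ball d"
  by (simp add: open_unit_ball_def topspace_Euclidean_space)

lemma continuous_on_sum_squares: "continuous_on S (\<lambda>x::nat \<Rightarrow> real. \<Sum>i<d. (x i)\<^sup>2)"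
  by (intro continuous_intros continuous_on_product_then_coordinatewise continuous_on_id)

lemma openin_Euclidean_space_Int:
  "open W \<Longrightarrow> openin (Euclidean_space d) (topspace (Euclidean_space d) \<inter> W)"
  by (metis Euclidean_space_def euclidean_product_topology openin_open_Int topspace_Euclidean_space)

lemma openin_open_unit_ball: "openin (Euclidean_space d) (open_unit_ball d)"
proof -
  have "open {x::nat \<Rightarrow> real. (\<Sum>i<d. (x i)\<^sup>2) < 1}"
    by (intro open_Collect_less continuous_on_sum_squares continuous_on_const)
  from openin_Euclidean_space_Int[OF this, of d] show ?thesis
    by (simp add: open_unit_ball_def Int_def)
qed

lemma compact_space_closed_unit_ball: "compact_space (closed_unit_ball d)"
proof -
  let ?S = "PiE UNIV (\<lambda>i::nat. if i < d then {-1..1} else {0::real})"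
  have "compactin (product_topology (\<lambda>i. euclideanreal) UNIV) ?S"
    by (subst compactin_PiE) auto
  then have comp: "compact ?S"
    by (simp add: euclidean_product_topology)
  have "closed {x::nat \<Rightarrow> real. (\<Sum>i<d. (x i)\<^sup>2) \<le> 1}"
    by (intro closed_Collect_le continuous_on_sum_squares continuous_on_const)
  then have comp_S: "compact (?S \<inter> {x. (\<Sum>i<d. (x i)\<^sup>2) \<le> 1})"
    using comp by (intro compact_Int_closed)
  have sub: "x i \<in> {-1..1}" if "(\<Sum>i<d. (x i)\<^sup>2) \<le> 1" "i < d" for x :: "nat \<Rightarrow> real" and i
  proof -
    have "(x i)\<^sup>2 \<le> (\<Sum>i<d. (x i)\<^sup>2)"
      using that(2) by (intro member_le_sum) auto
    with that(1) have "(x i)\<^sup>2 \<le> 1" by simp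
    then show ?thesis by (simp add: abs_square_le_1 abs_le_iff)
  qed
  have S_iff: "x \<in> ?S \<longleftrightarrow> (\<forall>i<d. x i \<in> {-1..1}) \<and> (\<forall>i\<ge>d. x i = 0)" for x
  proof -
    have "x \<in> ?S \<longleftrightarrow> (\<forall>i. x i \<in> (if i < d then {-1..1} else {0}))"
      unfolding PiE_UNIV_domain Pi_iff by blast
    also have "\<dots> \<longleftrightarrow> (\<forall>i. (i < d \<longrightarrow> x i \<in> {-1..1}) \<and> (d \<le> i \<longrightarrow> x i = 0))"
      by (intro all_cong1) simp
    finally show ?thesis by blast
  qed
  have "?S \<inter> {x. (\<Sum>i<d. (x i)\<^sup>2) \<le> 1} = {x. \<forall>i\<ge>d. x i = 0} \<inter> {x. (\<Sum>i<d. (x i)\<^sup>2) \<le> 1}"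
    using sub unfolding set_eq_iff Int_iff S_iff mem_Collect_eq by blast
  moreover have "closed_unit_ball d
      = top_of_set ({x. \<forall>i\<ge>d. x i = 0} \<inter> {x. (\<Sum>i<d. (x i)\<^sup>2) \<le> 1})"
    by (simp add: closed_unit_ball_def Euclidean_space_def euclidean_product_topology
        subtopology_subtopology)
  ultimately show ?thesis
    using comp_S by (simp add: compact_space_subtopology)
qed

text \<open>An open set that contains a point of a curve contains a further point of it. Applied to a coordinate
  line this separates open sets from coordinate subspaces, applied to a ray from closed balls.\<close>

lemma openin_Euclidean_space_curve:
  assumes W: "openin (Euclidean_space d) W" and g: "continuous_on UNIV g" "g 0 \<in> W"
    and gE: "\<And>t::real. g t \<in> topspace (Euclidean_space d)"
  obtains t where "t > 0" "g t \<in> W"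
proof -
  obtain V where V: "open V" "W = topspace (Euclidean_space d) \<inter> V"
    using W by (auto simp: Euclidean_space_def euclidean_product_topology openin_open)
  have "open (g -` V)"
    using g(1) V(1) by (simp add: open_vimage)
  moreover have "0 \<in> g -` V" using g(2) V(2) by simp
  ultimately obtain e where e: "e > 0" "ball 0 e \<subseteq> g -` V"
    using open_contains_ball by blast
  have "e / 2 \<in> ball 0 e" using e(1) by simp
  then have "g (e / 2) \<in> V" using e(2) by blast
  then have "g (e / 2) \<in> W" using V(2) gE by auto
  with e(1) show thesis by (intro that[of "e / 2"]) auto
qed

text \<open>A point of norm 1 can be pushed out of the ball by scaling, so it is not interior.\<close>

lemma open_subset_closed_unit_ball:
  assumes W: "openin (Euclidean_space d) W" "W \<subseteq> topspace (closed_unit_ball d)"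
  shows "W \<subseteq> open_unit_ball d"
proof
  fix x assume x: "x \<in> W"
  then have xE: "x \<in> topspace (Euclidean_space d)" and x1: "(\<Sum>i<d. (x i)\<^sup>2) \<le> 1"
    using W(2) by (auto simp: topspace_closed_unit_ball)
  obtain t where t: "t > 0" "(\<lambda>i. (1 + t) * x i) \<in> W"
  proof (rule openin_Euclidean_space_curve[OF W(1), of "\<lambda>t i. (1 + t) * x i"])
    show "continuous_on UNIV (\<lambda>t i. (1 + t) * x i)"
      by (intro continuous_on_coordinatewise_then_product continuous_intros)
    show "(\<lambda>i. (1 + t) * x i) \<in> topspace (Euclidean_space d)" for t
      using xE by (simp add: topspace_Euclidean_space)
  qed (use x in auto)
  have "(\<Sum>i<d. ((1 + t) * x i)\<^sup>2) \<le> 1"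
    using t(2) W(2) by (auto simp: topspace_closed_unit_ball)
  then have "(1 + t)\<^sup>2 * (\<Sum>i<d. (x i)\<^sup>2) \<le> 1"
    by (simp add: power_mult_distrib sum_distrib_left)
  moreover have "(1 + t)\<^sup>2 > 1" using t(1) by (simp add: one_less_power)
  ultimately have "(\<Sum>i<d. (x i)\<^sup>2) \<noteq> 1" by auto
  with x1 xE show "x \<in> open_unit_ball d"
    by (simp add: open_unit_ball_def)
qed

text \<open>Were the target of smaller dimension, invariance of domain in dimension \<open>m\<close> would make the image
  open, although it lies in a coordinate subspace, which a perturbation of coordinate \<open>n\<close> leaves.\<close>

lemma invariance_of_dimension_open_Euclidean_space:
  assumes U: "openin (Euclidean_space m) U" "U \<noteq> {}"
    and f: "continuous_map (subtopology (Euclidean_space m) U) (Euclidean_space n) f" "inj_on f U"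
  shows "m \<le> n"
proof (rule ccontr)
  assume nm: "\<not> m \<le> n"
  then have sub: "topspace (Euclidean_space n) \<subseteq> topspace (Euclidean_space m)"
    by (subst subset_Euclidean_space) simp
  have UE: "U \<subseteq> topspace (Euclidean_space m)"
    using U(1) by (rule openin_subset)
  have img: "f ` U \<subseteq> topspace (Euclidean_space n)"
    using continuous_map_image_subset_topspace[OF f(1)] UE by (simp add: Int_absorb1)
  have "continuous_map (subtopology (Euclidean_space m) U) (Euclidean_space m) f"
    using f(1) sub unfolding cm_Euclidean_space_iff_continuous_on by blast
  then have W: "openin (Euclidean_space m) (f ` U)"
    using U(1) f(2) by (intro invariance_of_domain_Euclidean_space)
  obtain x where x: "x \<in> f ` U" using U(2) by blast
  then have xE: "\<forall>i\<ge>n. x i = 0" using img by (auto simp: topspace_Euclidean_space)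
  obtain t where t: "t > 0" "x(n := x n + t) \<in> f ` U"
  proof (rule openin_Euclidean_space_curve[OF W, of "\<lambda>t. x(n := x n + t)"])
    show "continuous_on UNIV (\<lambda>t. x(n := x n + t))"
    proof (rule continuous_on_coordinatewise_then_product)
      show "continuous_on UNIV (\<lambda>t. (x(n := x n + t)) i)" for i
        by (cases "i = n") (auto intro!: continuous_intros)
    qed
    show "x(n := x n + t) \<in> topspace (Euclidean_space m)" for t
      using xE nm by (auto simp: topspace_Euclidean_space)
  qed (use x in auto)
  then have "x(n := x n + t) \<in> topspace (Euclidean_space n)" using img by blast
  then have "(x(n := x n + t)) n = 0" unfolding topspace_Euclidean_space by blast
  then show False using t(1) xE by simp
qed

lemma continuous_map_on_open_unit_ball:
  assumes "continuous_map (closed_unit_ball d) Y f"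
  shows "continuous_map (subtopology (Euclidean_space d) (open_unit_ball d)) Y f"
proof -
  have "open_unit_ball d \<subseteq> {x. (\<Sum>i<d. (x i)\<^sup>2) \<le> 1}"
    by (auto simp: open_unit_ball_def)
  then have "subtopology (Euclidean_space d) (open_unit_ball d)
      = subtopology (closed_unit_ball d) (open_unit_ball d)"
    by (simp add: closed_unit_ball_def subtopology_subtopology Int_absorb1)
  then show ?thesis
    using continuous_map_from_subtopology[OF assms] by simp
qed

lemma continuous_map_into_closed_unit_ball:
  "continuous_map Y (closed_unit_ball d) f \<Longrightarrow> continuous_map Y (Euclidean_space d) f"
  by (simp add: closed_unit_ball_def continuous_map_in_subtopology)

text \<open>For equal dimensions the image of the open ball is open by invariance of domain, and an open subset
  of the closed ball misses the sphere.\<close>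

lemma injective_map_closed_unit_balls:
  assumes f: "continuous_map (closed_unit_ball d) (closed_unit_ball e) f"
    "inj_on f (topspace (closed_unit_ball d))"
  shows "d \<le> e" "d = e \<Longrightarrow> f ` open_unit_ball d \<subseteq> open_unit_ball e"
proof -
  have cm: "continuous_map (subtopology (Euclidean_space d) (open_unit_ball d)) (Euclidean_space e) f"
    by (intro continuous_map_into_closed_unit_ball continuous_map_on_open_unit_ball f)
  have inj: "inj_on f (open_unit_ball d)"
    using f(2) open_unit_ball_subset inj_on_subset by blast
  show "d \<le> e"
    using invariance_of_dimension_open_Euclidean_space[OF openin_open_unit_ball _ cm inj]
      zero_in_open_unit_ball by blast
  show "f ` open_unit_ball d \<subseteq> open_unit_ball e" if "d = e"
  proof (rule open_subset_closed_unit_ball)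
    show "openin (Euclidean_space e) (f ` open_unit_ball d)"
      using cm inj that openin_open_unit_ball by (intro invariance_of_domain_Euclidean_space) auto
    show "f ` open_unit_ball d \<subseteq> topspace (closed_unit_ball e)"
      using continuous_map_image_subset_topspace[OF f(1)] open_unit_ball_subset by blast
  qed
qed

lemma homeomorphic_map_closed_unit_balls:
  assumes "homeomorphic_map (closed_unit_ball d) (closed_unit_ball e) f"
  shows "d = e" "f ` open_unit_ball d = open_unit_ball e"
proof -
  obtain g where fg: "homeomorphic_maps (closed_unit_ball d) (closed_unit_ball e) f g"
    using assms homeomorphic_map_maps by blast
  have cf: "continuous_map (closed_unit_ball d) (closed_unit_ball e) f"
    and cg: "continuous_map (closed_unit_ball e) (closed_unit_ball d) g"
    and gf: "\<And>x. x \<in> topspace (closed_unit_ball d) \<Longrightarrow> g (f x) = x"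
    and fg': "\<And>y. y \<in> topspace (closed_unit_ball e) \<Longrightarrow> f (g y) = y"
    using fg by (auto simp: homeomorphic_maps_def)
  have injf: "inj_on f (topspace (closed_unit_ball d))" by (rule inj_on_inverseI[of _ g]) (rule gf)
  have injg: "inj_on g (topspace (closed_unit_ball e))" by (rule inj_on_inverseI[of _ f]) (rule fg')
  show de: "d = e"
    using injective_map_closed_unit_balls(1)[OF cf injf] injective_map_closed_unit_balls(1)[OF cg injg] by simp
  show "f ` open_unit_ball d = open_unit_ball e"
  proof
    show "f ` open_unit_ball d \<subseteq> open_unit_ball e"
      using injective_map_closed_unit_balls(2)[OF cf injf de] .
    have "g ` open_unit_ball e \<subseteq> open_unit_ball d"
      using injective_map_closed_unit_balls(2)[OF cg injg de[symmetric]] .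
    then have "f ` g ` open_unit_ball e \<subseteq> f ` open_unit_ball d" by blast
    moreover have "f ` g ` open_unit_ball e = open_unit_ball e"
      using fg' open_unit_ball_subset[of e] by (auto simp: image_image subset_iff image_iff)
    ultimately show "open_unit_ball e \<subseteq> f ` open_unit_ball d" by simp
  qed
qed

section \<open>Cells and their dimensions\<close>

lemma ball_likeE:
  assumes "ball_like X \<sigma> d"
  obtains f g where "homeomorphic_maps (closed_unit_ball d) (subtopology X \<sigma>) f g"
    "homeomorphic_map (closed_unit_ball d) (subtopology X \<sigma>) f"
  using assms unfolding ball_like_def
  by (meson homeomorphic_map_maps homeomorphic_space homeomorphic_space_sym)

lemma homeomorphic_map_cell_unique:
  assumes f: "homeomorphic_map (closed_unit_ball d) (subtopology X \<sigma>) f"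
    and g: "homeomorphic_map (closed_unit_ball e) (subtopology X \<sigma>) g"
  shows "d = e" "f ` open_unit_ball d = g ` open_unit_ball e"
proof -
  obtain g' where g': "homeomorphic_maps (closed_unit_ball e) (subtopology X \<sigma>) g g'"
    using g homeomorphic_map_maps by blast
  have "homeomorphic_map (subtopology X \<sigma>) (closed_unit_ball e) g'"
    using g' homeomorphic_maps_sym homeomorphic_maps_map by blast
  then have h: "homeomorphic_map (closed_unit_ball d) (closed_unit_ball e) (g' \<circ> f)"
    using f homeomorphic_map_compose by blast
  show "d = e" using homeomorphic_map_closed_unit_balls(1)[OF h] .
  have fim: "f x \<in> topspace (subtopology X \<sigma>)" if "x \<in> open_unit_ball d" for x
    using f that open_unit_ball_subset homeomorphic_imp_surjective_map by blast
  have "g ` open_unit_ball e = g ` (g' \<circ> f) ` open_unit_ball d"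
    using homeomorphic_map_closed_unit_balls(2)[OF h] by simp
  also have "\<dots> = f ` open_unit_ball d"
    using g' fim by (force simp: homeomorphic_maps_def image_iff)
  finally show "f ` open_unit_ball d = g ` open_unit_ball e" by simp
qed

lemma cell_dim_eq:
  assumes "ball_like X \<sigma> d"
  shows "cell_dim X \<sigma> = d"
  unfolding cell_dim_def
proof (rule the_equality)
  fix e assume "ball_like X \<sigma> e"
  then show "e = d"
    using assms by (elim ball_likeE) (rule homeomorphic_map_cell_unique(1))
qed (rule assms)

text \<open>Homeomorphisms of balls preserve the sphere, so a single chart determines the relative interior.\<close>

lemma cell_interior_eq:
  assumes "homeomorphic_map (closed_unit_ball d) (subtopology X \<sigma>) f"
  shows "cell_interior X \<sigma> = f ` open_unit_ball d"
proof
  show "cell_interior X \<sigma> \<subseteq> f ` open_unit_ball d"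
  proof
    fix y assume "y \<in> cell_interior X \<sigma>"
    then obtain g e x where g: "homeomorphic_map (closed_unit_ball e) (subtopology X \<sigma>) g"
      and x: "x \<in> topspace (closed_unit_ball e)" "(\<Sum>i<e. (x i)\<^sup>2) < 1" "y = g x"
      unfolding cell_interior_def by blast
    have "y \<in> g ` open_unit_ball e"
      using x by (auto simp: open_unit_ball_def topspace_closed_unit_ball)
    also have "g ` open_unit_ball e = f ` open_unit_ball d"
      by (rule homeomorphic_map_cell_unique(2)[OF g assms])
    finally show "y \<in> f ` open_unit_ball d" .
  qed
  show "f ` open_unit_ball d \<subseteq> cell_interior X \<sigma>"
  proof (rule image_subsetI)
    fix x assume x: "x \<in> open_unit_ball d"
    then have "x \<in> topspace (closed_unit_ball d)" "(\<Sum>i<d. (x i)\<^sup>2) < 1"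
      using open_unit_ball_subset by (auto simp: open_unit_ball_def)
    then show "f x \<in> cell_interior X \<sigma>" unfolding cell_interior_def using assms by blast
  qed
qed

text \<open>The finite case of the Baire category theorem, valid in every topological space: remove one closed
  set at a time from an open set.\<close>

lemma finite_closed_cover_interior:
  assumes "finite F" "openin Y V" "V \<noteq> {}" "V \<subseteq> \<Union>F" "\<And>A. A \<in> F \<Longrightarrow> closedin Y A"
  obtains A W where "A \<in> F" "openin Y W" "W \<noteq> {}" "W \<subseteq> A"
proof -
  have "\<exists>A W. A \<in> F \<and> openin Y W \<and> W \<noteq> {} \<and> W \<subseteq> A"
    using assms
  proof (induction F arbitrary: V)
    case empty
    then show ?case by simp
  next
    case (insert A F)
    show ?case
    proof (cases "V \<subseteq> A")
      case True
      then show ?thesis using insert.prems(1,2) by (intro exI[of _ A] exI[of _ V]) simp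
    next
      case False
      have "\<exists>B W. B \<in> F \<and> openin Y W \<and> W \<noteq> {} \<and> W \<subseteq> B"
      proof (rule insert.IH)
        show "openin Y (V - A)" using insert.prems(1,4) by (intro openin_diff) simp_all
        show "V - A \<noteq> {}" using False by blast
        show "V - A \<subseteq> \<Union>F" using insert.prems(3) by auto
        show "closedin Y B" if "B \<in> F" for B using insert.prems(4) that by simp
      qed
      then obtain B W where "B \<in> F" "openin Y W" "W \<noteq> {}" "W \<subseteq> B" by (elim exE conjE)
      then show ?thesis by (intro exI[of _ B] exI[of _ W]) simp
    qed
  qed
  then show thesis by (elim exE conjE) (rule that)
qed

context
  fixes X :: "'a topology" and L :: "'a set set"
  assumes L: "regular_cell_complex X L"
begin

lemma Hausdorff_cell_complex: "Hausdorff_space X"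
  using L unfolding regular_cell_complex_def by (elim conjE)

lemma finite_cell_complex: "finite L"
  using L unfolding regular_cell_complex_def by (elim conjE)

lemma disjoint_cell_interiors: "disjoint_family_on (cell_interior X) (L - {{}})"
  using L unfolding regular_cell_complex_def by (elim conjE)

lemma cell_boundaryE:
  assumes "\<sigma> \<in> L"
  obtains K where "K \<subseteq> L" "cell_boundary X \<sigma> = \<Union>K"
proof -
  have "\<forall>\<sigma>\<in>L. \<exists>K\<subseteq>L. cell_boundary X \<sigma> = \<Union>K"
    using L unfolding regular_cell_complex_def by (elim conjE)
  then have "\<exists>K\<subseteq>L. cell_boundary X \<sigma> = \<Union>K" using assms by (rule bspec)
  then show thesis by (elim exE conjE) (rule that)
qed

lemma cell_ball_like: "\<sigma> \<in> L \<Longrightarrow> \<sigma> \<noteq> {} \<Longrightarrow> ball_like X \<sigma> (cell_dim X \<sigma>)"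
proof -
  assume "\<sigma> \<in> L" "\<sigma> \<noteq> {}"
  then have "\<sigma> \<in> L - {{}}" by simp
  moreover have "\<forall>\<sigma>\<in>L - {{}}. \<exists>d. ball_like X \<sigma> d"
    using L unfolding regular_cell_complex_def by (elim conjE)
  ultimately obtain d where "ball_like X \<sigma> d" by blast
  then show ?thesis using cell_dim_eq[of X \<sigma> d] by simp
qed

lemma cell_chartE:
  assumes "\<sigma> \<in> L" "\<sigma> \<noteq> {}"
  obtains f g where "continuous_map (closed_unit_ball (cell_dim X \<sigma>)) (subtopology X \<sigma>) f"
    "continuous_map (subtopology X \<sigma>) (closed_unit_ball (cell_dim X \<sigma>)) g"
    "\<forall>x\<in>topspace (closed_unit_ball (cell_dim X \<sigma>)). f x \<in> \<sigma> \<and> g (f x) = x"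
    "\<forall>y\<in>\<sigma>. g y \<in> topspace (closed_unit_ball (cell_dim X \<sigma>)) \<and> f (g y) = y"
    "cell_interior X \<sigma> = f ` open_unit_ball (cell_dim X \<sigma>)"
proof -
  have b: "ball_like X \<sigma> (cell_dim X \<sigma>)" using cell_ball_like assms .
  then have sub: "topspace X \<inter> \<sigma> = \<sigma>" by (auto simp: ball_like_def)
  obtain f g where fg: "homeomorphic_maps (closed_unit_ball (cell_dim X \<sigma>)) (subtopology X \<sigma>) f g"
    and f: "homeomorphic_map (closed_unit_ball (cell_dim X \<sigma>)) (subtopology X \<sigma>) f"
    using ball_likeE[OF b] .
  have cm: "continuous_map (closed_unit_ball (cell_dim X \<sigma>)) (subtopology X \<sigma>) f"
    "continuous_map (subtopology X \<sigma>) (closed_unit_ball (cell_dim X \<sigma>)) g"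
    and inv: "\<And>x. x \<in> topspace (closed_unit_ball (cell_dim X \<sigma>)) \<Longrightarrow> g (f x) = x"
    "\<And>y. y \<in> \<sigma> \<Longrightarrow> f (g y) = y"
    using fg unfolding homeomorphic_maps_def topspace_subtopology sub by auto
  have "f ` topspace (closed_unit_ball (cell_dim X \<sigma>)) \<subseteq> \<sigma>"
    "g ` \<sigma> \<subseteq> topspace (closed_unit_ball (cell_dim X \<sigma>))"
    using cm[THEN continuous_map_image_subset_topspace] unfolding topspace_subtopology sub by auto
  then show thesis
    using cm inv cell_interior_eq[OF f] by (intro that[of f g]) auto
qed

lemma closedin_cell: "\<sigma> \<in> L \<Longrightarrow> closedin X \<sigma>"
proof (cases "\<sigma> = {}")
  case False
  assume s: "\<sigma> \<in> L"
  have b: "ball_like X \<sigma> (cell_dim X \<sigma>)" using cell_ball_like s False .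
  then have "compact_space (subtopology X \<sigma>)"
    using homeomorphic_compact_space[of "subtopology X \<sigma>"] compact_space_closed_unit_ball
    unfolding ball_like_def by blast
  then have "compactin X \<sigma>"
    using b by (simp add: ball_like_def compactin_subspace)
  then show ?thesis
    by (rule compactin_imp_closedin[OF Hausdorff_cell_complex])
qed simp

lemma cell_interior_nonempty:
  assumes "\<sigma> \<in> L" "\<sigma> \<noteq> {}"
  shows "cell_interior X \<sigma> \<noteq> {}" "cell_interior X \<sigma> \<subseteq> \<sigma>"
proof -
  obtain f g where f: "continuous_map (closed_unit_ball (cell_dim X \<sigma>)) (subtopology X \<sigma>) f"
    "continuous_map (subtopology X \<sigma>) (closed_unit_ball (cell_dim X \<sigma>)) g"
    "\<forall>x\<in>topspace (closed_unit_ball (cell_dim X \<sigma>)). f x \<in> \<sigma> \<and> g (f x) = x"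
    "\<forall>y\<in>\<sigma>. g y \<in> topspace (closed_unit_ball (cell_dim X \<sigma>)) \<and> f (g y) = y"
    and int: "cell_interior X \<sigma> = f ` open_unit_ball (cell_dim X \<sigma>)"
    using cell_chartE[OF assms] .
  show "cell_interior X \<sigma> \<noteq> {}"
    unfolding int using zero_in_open_unit_ball by blast
  show "cell_interior X \<sigma> \<subseteq> \<sigma>"
    unfolding int using f(3) open_unit_ball_subset by (intro image_subsetI) blast
qed

text \<open>Descend from \<open>\<tau>\<close> through cells that contain a fixed point of the interior of \<open>\<sigma>\<close>: as long as that
  point is on the boundary of the current cell, the boundary provides a smaller one. The descent ends
  with a cell that has the point in its interior, and this cell is \<open>\<sigma>\<close> by disjointness.\<close>

lemma cell_meets_interior_imp_subset:
  assumes "\<tau> \<in> L" "\<sigma> \<in> L" "\<sigma> \<noteq> {}" "\<tau> \<inter> cell_interior X \<sigma> \<noteq> {}"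
  shows "\<sigma> \<subseteq> \<tau>"
  using assms
proof (induction "card {\<rho> \<in> L. \<rho> \<subseteq> \<tau>}" arbitrary: \<tau> rule: less_induct)
  case less
  have \<tau>: "\<tau> \<noteq> {}" using less.prems by blast
  obtain x where x: "x \<in> \<tau>" "x \<in> cell_interior X \<sigma>" using less.prems by blast
  show ?case
  proof (cases "x \<in> cell_interior X \<tau>")
    case True
    have "\<sigma> = \<tau>"
    proof (rule ccontr)
      assume "\<sigma> \<noteq> \<tau>"
      then have "cell_interior X \<sigma> \<inter> cell_interior X \<tau> = {}"
        using less.prems \<tau> by (intro disjoint_family_onD[OF disjoint_cell_interiors]) auto
      then show False using True x(2) by blast
    qed
    then show ?thesis by simp
  next
    case False
    then have "x \<in> cell_boundary X \<tau>" using x by (simp add: cell_boundary_def)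
    moreover obtain K where K: "K \<subseteq> L" "cell_boundary X \<tau> = \<Union>K"
      using cell_boundaryE[OF less.prems(1)] .
    ultimately obtain \<rho> where \<rho>: "\<rho> \<in> K" "x \<in> \<rho>" by blast
    have "\<rho> \<subseteq> \<tau> - cell_interior X \<tau>" using \<rho>(1) K(2) by (auto simp: cell_boundary_def)
    then have sub: "\<rho> \<subset> \<tau>" using cell_interior_nonempty[OF less.prems(1) \<tau>] by blast
    have "{\<rho>' \<in> L. \<rho>' \<subseteq> \<rho>} \<subset> {\<rho>' \<in> L. \<rho>' \<subseteq> \<tau>}"
      using sub less.prems(1) by auto
    then have "card {\<rho>' \<in> L. \<rho>' \<subseteq> \<rho>} < card {\<rho>' \<in> L. \<rho>' \<subseteq> \<tau>}"
      using finite_cell_complex by (intro psubset_card_mono) auto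
    moreover have "\<rho> \<in> L" using \<rho>(1) K(1) by auto
    ultimately have "\<sigma> \<subseteq> \<rho>"
      using less.hyps less.prems x(2) \<rho>(2) by blast
    then show ?thesis using sub by blast
  qed
qed

text \<open>A proper face avoids the interior, hence is an embedded ball in a sphere. It cannot have the
  dimension of the surrounding ball, because then its interior would lie in the open ball.\<close>

lemma cell_dim_strict_mono:
  assumes \<tau>: "\<tau> \<in> L" "\<tau> \<noteq> {}" and \<sigma>: "\<sigma> \<in> L" "\<tau> \<subset> \<sigma>"
  shows "cell_dim X \<tau> < cell_dim X \<sigma>"
proof -
  have \<sigma>0: "\<sigma> \<noteq> {}" using \<sigma> by blast
  obtain f g where f: "continuous_map (closed_unit_ball (cell_dim X \<tau>)) (subtopology X \<tau>) f"
    "continuous_map (subtopology X \<tau>) (closed_unit_ball (cell_dim X \<tau>)) g"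
    "\<forall>x\<in>topspace (closed_unit_ball (cell_dim X \<tau>)). f x \<in> \<tau> \<and> g (f x) = x"
    "\<forall>y\<in>\<tau>. g y \<in> topspace (closed_unit_ball (cell_dim X \<tau>)) \<and> f (g y) = y"
    and int_f: "cell_interior X \<tau> = f ` open_unit_ball (cell_dim X \<tau>)"
    using cell_chartE[OF \<tau>] .
  obtain f' g' where g': "continuous_map (closed_unit_ball (cell_dim X \<sigma>)) (subtopology X \<sigma>) f'"
    "continuous_map (subtopology X \<sigma>) (closed_unit_ball (cell_dim X \<sigma>)) g'"
    "\<forall>x\<in>topspace (closed_unit_ball (cell_dim X \<sigma>)). f' x \<in> \<sigma> \<and> g' (f' x) = x"
    "\<forall>y\<in>\<sigma>. g' y \<in> topspace (closed_unit_ball (cell_dim X \<sigma>)) \<and> f' (g' y) = y"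
    and int: "cell_interior X \<sigma> = f' ` open_unit_ball (cell_dim X \<sigma>)"
    using cell_chartE[OF \<sigma>(1) \<sigma>0] .
  have disj: "\<tau> \<inter> cell_interior X \<sigma> = {}"
    using cell_meets_interior_imp_subset[OF \<tau>(1) \<sigma>(1) \<sigma>0] \<sigma>(2) by blast
  let ?h = "g' \<circ> f"
  have "continuous_map (closed_unit_ball (cell_dim X \<tau>)) (subtopology X \<sigma>) f"
    using f(1) \<sigma>(2) by (auto simp: continuous_map_in_subtopology)
  then have h: "continuous_map (closed_unit_ball (cell_dim X \<tau>)) (closed_unit_ball (cell_dim X \<sigma>)) ?h"
    using g'(2) by (rule continuous_map_compose)
  have left_inverse: "g (f' (?h x)) = x" if "x \<in> topspace (closed_unit_ball (cell_dim X \<tau>))" for x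
    using f(3) g'(4) that \<sigma>(2) by auto
  have inj: "inj_on ?h (topspace (closed_unit_ball (cell_dim X \<tau>)))"
    using left_inverse by (intro inj_on_inverseI[of _ "g \<circ> f'"]) simp
  have "cell_dim X \<tau> \<noteq> cell_dim X \<sigma>"
  proof
    assume "cell_dim X \<tau> = cell_dim X \<sigma>"
    from injective_map_closed_unit_balls(2)[OF h inj this]
    have "?h (\<lambda>i. 0) \<in> open_unit_ball (cell_dim X \<sigma>)" using zero_in_open_unit_ball by blast
    then have "f' (?h (\<lambda>i. 0)) \<in> cell_interior X \<sigma>" using int by blast
    moreover have "f (\<lambda>i. 0) \<in> \<tau>" using f(3) zero_in_open_unit_ball open_unit_ball_subset by blast
    moreover have "f' (?h (\<lambda>i. 0)) = f (\<lambda>i. 0)" using g'(4) calculation \<sigma>(2) by auto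
    ultimately show False using disj by auto
  qed
  with injective_map_closed_unit_balls(1)[OF h inj] show ?thesis by simp
qed

text \<open>The open upper hemisphere of the boundary sphere is the graph of a function on the \<open>D\<close>-dimensional
  open ball. Finitely many closed cells cover it, so one of them contains the image of a nonempty open
  subset of \<open>D\<close>-space and has dimension at least \<open>D\<close>.\<close>

lemma cell_has_facet:
  assumes \<sigma>: "\<sigma> \<in> L" "\<sigma> \<noteq> {}" and dim: "cell_dim X \<sigma> = Suc D"
  obtains \<tau> where "\<tau> \<in> L" "\<tau> \<noteq> {}" "\<tau> \<subset> \<sigma>" "cell_dim X \<tau> = D"
proof -
  obtain f g where f: "continuous_map (closed_unit_ball (Suc D)) (subtopology X \<sigma>) f"
    "continuous_map (subtopology X \<sigma>) (closed_unit_ball (Suc D)) g"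
    "\<forall>x\<in>topspace (closed_unit_ball (Suc D)). f x \<in> \<sigma> \<and> g (f x) = x"
    "\<forall>y\<in>\<sigma>. g y \<in> topspace (closed_unit_ball (Suc D)) \<and> f (g y) = y"
    and int: "cell_interior X \<sigma> = f ` open_unit_ball (Suc D)"
    using cell_chartE[OF \<sigma>] unfolding dim .
  obtain K where K: "K \<subseteq> L" "cell_boundary X \<sigma> = \<Union>K"
    using cell_boundaryE[OF \<sigma>(1)] .
  have finK: "finite K" using finite_subset[OF K(1) finite_cell_complex] .
  \<comment> \<open>The chart of the open upper hemisphere.\<close>
  define q :: "(nat \<Rightarrow> real) \<Rightarrow> nat \<Rightarrow> real" where
    "q y = y(D := sqrt (1 - (\<Sum>i<D. (y i)\<^sup>2)))" for y
  let ?U = "open_unit_ball D"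
  let ?Y = "subtopology (Euclidean_space D) ?U"
  have topY: "topspace ?Y = ?U" by (auto simp: open_unit_ball_def)
  have q_norm: "(\<Sum>i<Suc D. (q y i)\<^sup>2) = 1" if "y \<in> ?U" for y
    using that by (simp add: q_def open_unit_ball_def)
  have q_E: "q y \<in> topspace (Euclidean_space (Suc D))" if "y \<in> ?U" for y
    using that by (auto simp: q_def open_unit_ball_def topspace_Euclidean_space)
  have q_ball: "q y \<in> topspace (closed_unit_ball (Suc D))" if "y \<in> ?U" for y
    using q_norm[OF that] q_E[OF that] by (simp add: topspace_closed_unit_ball)
  have q_cont: "continuous_map ?Y (closed_unit_ball (Suc D)) q"
  proof -
    have "continuous_on ?U q"
    proof (rule continuous_on_coordinatewise_then_product)
      fix i
      have "continuous_on ?U (\<lambda>y. sqrt (1 - (\<Sum>i<D. (y i)\<^sup>2)))"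
        by (intro continuous_intros continuous_on_sum_squares)
      moreover have "continuous_on ?U (\<lambda>y. y i)"
        by (rule continuous_on_product_then_coordinatewise[OF continuous_on_id])
      ultimately show "continuous_on ?U (\<lambda>y. q y i)"
        by (cases "i = D") (simp_all add: q_def)
    qed
    then have "continuous_map ?Y (Euclidean_space (Suc D)) q"
      unfolding cm_Euclidean_space_iff_continuous_on topY using q_E by blast
    then show ?thesis
      unfolding closed_unit_ball_def continuous_map_in_subtopology topY using q_norm by fastforce
  qed
  have q_inj: "y = z" if "y \<in> ?U" "z \<in> ?U" "q y = q z" for y z
  proof
    fix i
    show "y i = z i"
    proof (cases "i = D")
      case True
      then show ?thesis using that by (simp add: open_unit_ball_def topspace_Euclidean_space)
    next
      case False
      then show ?thesis using fun_cong[OF that(3), of i] by (simp add: q_def)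
    qed
  qed
  have fq: "continuous_map ?Y X (f \<circ> q)"
    using continuous_map_compose[OF q_cont f(1)] continuous_map_into_fulltopology by blast
  define A where "A \<tau> = {y \<in> ?U. f (q y) \<in> \<tau>}" for \<tau>
  have A_closed: "closedin ?Y (A \<tau>)" if "\<tau> \<in> K" for \<tau>
    using closedin_continuous_map_preimage[OF fq closedin_cell, of \<tau>] that K(1)
    unfolding topY A_def by auto
  have cover: "?U \<subseteq> \<Union>(A ` K)"
  proof
    fix y assume y: "y \<in> ?U"
    have "f (q y) \<notin> cell_interior X \<sigma>"
    proof
      assume "f (q y) \<in> cell_interior X \<sigma>"
      then obtain z where z: "z \<in> open_unit_ball (Suc D)" "f (q y) = f z" using int by blast
      then have "q y = z"
        using f(3) q_ball[OF y] open_unit_ball_subset by (metis subsetD)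
      then show False using z(1) q_norm[OF y] by (simp add: open_unit_ball_def)
    qed
    then have "f (q y) \<in> \<Union>K"
      using f(3) q_ball[OF y] K(2) by (auto simp: cell_boundary_def)
    then show "y \<in> \<Union>(A ` K)" using y by (auto simp: A_def)
  qed
  obtain B W where B: "B \<in> A ` K" and W': "openin ?Y W" "W \<noteq> {}" "W \<subseteq> B"
  proof (rule finite_closed_cover_interior[of "A ` K" ?Y ?U])
    show "openin ?Y ?U" by (metis topY openin_topspace)
    show "?U \<noteq> {}" using zero_in_open_unit_ball by blast
  qed (use finK cover A_closed in auto)
  then obtain \<tau> where \<tau>: "\<tau> \<in> K" and W: "openin ?Y W" "W \<noteq> {}" "W \<subseteq> A \<tau>" by blast
  have \<tau>L: "\<tau> \<in> L" using \<tau> K(1) by blast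
  have \<tau>0: "\<tau> \<noteq> {}" using W by (auto simp: A_def)
  have "\<tau> \<subseteq> \<sigma> - cell_interior X \<sigma>" using \<tau> K(2) by (auto simp: cell_boundary_def)
  then have \<tau>\<sigma>: "\<tau> \<subset> \<sigma>" using cell_interior_nonempty[OF \<sigma>] by blast
  obtain f' g' where g': "continuous_map (closed_unit_ball (cell_dim X \<tau>)) (subtopology X \<tau>) f'"
    "continuous_map (subtopology X \<tau>) (closed_unit_ball (cell_dim X \<tau>)) g'"
    "\<forall>x\<in>topspace (closed_unit_ball (cell_dim X \<tau>)). f' x \<in> \<tau> \<and> g' (f' x) = x"
    "\<forall>y\<in>\<tau>. g' y \<in> topspace (closed_unit_ball (cell_dim X \<tau>)) \<and> f' (g' y) = y"
    and int_g': "cell_interior X \<tau> = f' ` open_unit_ball (cell_dim X \<tau>)"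
    using cell_chartE[OF \<tau>L \<tau>0] .
  have WU: "W \<subseteq> ?U" using W(1) topY openin_subset by metis
  have W_open: "openin (Euclidean_space D) W"
    using W(1) openin_open_unit_ball openin_trans_full by blast
  have "continuous_map (subtopology (Euclidean_space D) W) X (f \<circ> q)"
    using continuous_map_from_subtopology[OF fq, of W] WU
    by (simp add: subtopology_subtopology Int_absorb1)
  then have "continuous_map (subtopology (Euclidean_space D) W) (subtopology X \<tau>) (f \<circ> q)"
    using W(3) by (auto simp: continuous_map_in_subtopology A_def)
  then have cm: "continuous_map (subtopology (Euclidean_space D) W) (Euclidean_space (cell_dim X \<tau>))
      (g' \<circ> (f \<circ> q))"
    using g'(2) by (rule continuous_map_into_closed_unit_ball[OF continuous_map_compose])
  have "inj_on (g' \<circ> (f \<circ> q)) W"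
  proof (rule inj_onI)
    fix y z assume yz: "y \<in> W" "z \<in> W" "(g' \<circ> (f \<circ> q)) y = (g' \<circ> (f \<circ> q)) z"
    have "f (q y) = f (q z)"
      using yz W(3) g'(4) by (metis (mono_tags, lifting) A_def comp_apply mem_Collect_eq subsetD)
    then have "q y = q z"
      using yz WU f(3) q_ball by (metis subsetD)
    then show "y = z" using q_inj yz WU by blast
  qed
  then have "D \<le> cell_dim X \<tau>"
    using invariance_of_dimension_open_Euclidean_space[OF W_open W(2) cm] by blast
  moreover have "cell_dim X \<tau> < Suc D"
    using cell_dim_strict_mono[OF \<tau>L \<tau>0 \<sigma>(1) \<tau>\<sigma>] dim by simp
  ultimately show thesis using that \<tau>L \<tau>0 \<tau>\<sigma> by simp
qed

end

section \<open>Faces of the cube\<close>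

definition cube :: "nat \<Rightarrow> (nat \<Rightarrow> real) set" where
  "cube d = PiE {..<d} (\<lambda>_. {0..1})"

text \<open>The dimension of a face is the number of coordinates that vary on it; this formula does not
  mention the choice of factors by which a face is presented.\<close>

definition face_dim :: "nat \<Rightarrow> (nat \<Rightarrow> real) set \<Rightarrow> nat" where
  "face_dim n F = card {i \<in> {..<n}. \<exists>x\<in>F. \<exists>y\<in>F. x i \<noteq> y i}"

text \<open>The three possible factors of a face of the standard cube.\<close>

definition sides :: "real set set" where
  "sides = {{0}, {1}, {0..1}}"

lemma in_sides [simp]: "{0} \<in> sides" "{1} \<in> sides" "{0..1} \<in> sides"
  by (simp_all add: sides_def)

lemma side_cases:
  assumes "a \<in> sides"
  obtains "a = {0}" | "a = {1}" | "a = {0..1}"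
  using assms unfolding sides_def by blast

lemma finite_sides: "finite sides"
  by (simp add: sides_def)

lemma side_nonempty: "a \<in> sides \<Longrightarrow> a \<noteq> {}"
  by (erule side_cases) simp_all

lemma side_subset_interval: "a \<in> sides \<Longrightarrow> a \<subseteq> {0..1}"
  by (erule side_cases) simp_all

lemma interval_not_singleton [simp]: "{0..1::real} \<noteq> {c}" "{c} \<noteq> {0..1::real}"
proof -
  show "{0..1::real} \<noteq> {c}"
  proof
    assume "{0..1::real} = {c}"
    then have "0 \<in> {c}" "1 \<in> {c}" by (metis atLeastAtMost_iff order_refl zero_le_one)+
    then show False by simp
  qed
  then show "{c} \<noteq> {0..1::real}" by (rule not_sym)
qed

text \<open>Factors are comparable only if they are equal or one of them is the whole interval; so inclusion of
  faces amounts to freeing some coordinates.\<close>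

lemma side_subset_iff:
  assumes "a \<in> sides" "b \<in> sides"
  shows "a \<subseteq> b \<longleftrightarrow> a = b \<or> b = {0..1}"
proof
  assume sub: "a \<subseteq> b"
  show "a = b \<or> b = {0..1}"
  proof (cases rule: side_cases[OF assms(2)])
    case 1
    then show ?thesis using sub side_nonempty[OF assms(1)] by (simp add: subset_singleton_iff)
  next
    case 2
    then show ?thesis using sub side_nonempty[OF assms(1)] by (simp add: subset_singleton_iff)
  qed simp
qed (use side_subset_interval[OF assms(1)] in auto)

lemma cube_faceE:
  assumes "F \<in> cube_faces n"
  obtains s where "F = PiE {..<n} s" "\<And>i. i < n \<Longrightarrow> s i \<in> sides"
  using assms unfolding cube_faces_def sides_def by blast

lemma cube_faceI: "(\<And>i. i < n \<Longrightarrow> s i \<in> sides) \<Longrightarrow> PiE {..<n} s \<in> cube_faces n"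
  unfolding cube_faces_def sides_def by blast

lemma face_nonempty: "(\<And>i. i < n \<Longrightarrow> s i \<in> sides) \<Longrightarrow> PiE {..<n} s \<noteq> {}"
  unfolding PiE_eq_empty_iff using side_nonempty by blast

lemma empty_notin_cube_faces: "{} \<notin> cube_faces n"
  by (metis cube_faceE face_nonempty)

lemma face_subset_iff:
  assumes "\<And>i. i < n \<Longrightarrow> s i \<in> sides"
  shows "PiE {..<n} s \<subseteq> PiE {..<n} t \<longleftrightarrow> (\<forall>i<n. s i \<subseteq> t i)"
  using face_nonempty[of n s] assms by (auto simp: subset_PiE)

lemma cube_in_cube_faces: "cube n \<in> cube_faces n"
  unfolding cube_def by (rule cube_faceI) simp

lemma face_subset_cube: "F \<in> cube_faces n \<Longrightarrow> F \<subseteq> cube n"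
proof (elim cube_faceE)
  fix s assume F: "F = PiE {..<n} s" and s: "\<And>i. i < n \<Longrightarrow> s i \<in> sides"
  have "s i \<subseteq> {0..1}" if "i < n" for i
    using side_subset_interval[OF s[OF that]] .
  then show "F \<subseteq> cube n" unfolding F cube_def by (intro PiE_mono) simp
qed

lemma cube_faces_eq_image: "cube_faces n = PiE {..<n} ` PiE {..<n} (\<lambda>_. sides)"
proof
  show "cube_faces n \<subseteq> PiE {..<n} ` PiE {..<n} (\<lambda>_. sides)"
  proof
    fix F assume "F \<in> cube_faces n"
    then obtain s where s: "F = PiE {..<n} s" "\<And>i. i < n \<Longrightarrow> s i \<in> sides"
      using cube_faceE by metis
    have "F = PiE {..<n} (restrict s {..<n})" unfolding s(1) by (rule PiE_cong) simp
    moreover have "restrict s {..<n} \<in> PiE {..<n} (\<lambda>_. sides)" using s(2) by auto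
    ultimately show "F \<in> PiE {..<n} ` PiE {..<n} (\<lambda>_. sides)" by blast
  qed
  show "PiE {..<n} ` PiE {..<n} (\<lambda>_. sides) \<subseteq> cube_faces n"
  proof (rule image_subsetI)
    fix s assume "s \<in> PiE {..<n} (\<lambda>_. sides)"
    then show "PiE {..<n} s \<in> cube_faces n" by (intro cube_faceI) (simp add: PiE_iff)
  qed
qed

lemma finite_cube_faces: "finite (cube_faces n)"
  unfolding cube_faces_eq_image by (intro finite_imageI finite_PiE finite_sides) simp

lemma inj_on_face: "inj_on (PiE {..<n}) (PiE {..<n} (\<lambda>_. sides))"
proof (rule inj_onI)
  fix s t assume st: "s \<in> PiE {..<n} (\<lambda>_. sides)" "t \<in> PiE {..<n} (\<lambda>_. sides)"
    and eq: "PiE {..<n} s = PiE {..<n} t"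
  have side: "s i \<in> sides" "t i \<in> sides" if "i < n" for i
    using st that by (auto simp: PiE_iff)
  have "\<forall>i<n. s i \<subseteq> t i" "\<forall>i<n. t i \<subseteq> s i"
    using eq face_subset_iff[of n s t, OF side(1)] face_subset_iff[of n t s, OF side(2)] by simp_all
  then show "s = t" by (intro PiE_ext[OF st]) (simp add: subset_antisym)
qed

lemma face_dim_PiE:
  assumes s: "\<And>i. i < n \<Longrightarrow> s i \<in> sides"
  shows "face_dim n (PiE {..<n} s) = card {i \<in> {..<n}. s i = {0..1}}"
proof -
  have "(\<exists>x\<in>PiE {..<n} s. \<exists>y\<in>PiE {..<n} s. x i \<noteq> y i) \<longleftrightarrow> s i = {0..1}" if i: "i < n" for i
  proof -
    have "(\<exists>x\<in>PiE {..<n} s. \<exists>y\<in>PiE {..<n} s. x i \<noteq> y i)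
        \<longleftrightarrow> (\<exists>a\<in>(\<lambda>x. x i) ` PiE {..<n} s. \<exists>b\<in>(\<lambda>x. x i) ` PiE {..<n} s. a \<noteq> b)"
      by blast
    also have "(\<lambda>x. x i) ` PiE {..<n} s = s i"
      using face_nonempty[of n s, OF s] i unfolding image_projection_PiE by simp
    also have "(\<exists>a\<in>s i. \<exists>b\<in>s i. a \<noteq> b) \<longleftrightarrow> s i = {0..1}"
    proof
      assume ne: "\<exists>a\<in>s i. \<exists>b\<in>s i. a \<noteq> b"
      then show "s i = {0..1}" by (cases rule: side_cases[OF s[OF i]]) simp_all
    next
      assume "s i = {0..1}"
      then have "0 \<in> s i" "1 \<in> s i" by simp_all
      then show "\<exists>a\<in>s i. \<exists>b\<in>s i. a \<noteq> b" using zero_neq_one[where 'a = real] by blast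
    qed
    finally show ?thesis .
  qed
  then have "{i \<in> {..<n}. \<exists>x\<in>PiE {..<n} s. \<exists>y\<in>PiE {..<n} s. x i \<noteq> y i}
      = {i \<in> {..<n}. s i = {0..1}}" by (intro Collect_cong conj_cong refl) simp
  then show ?thesis by (simp add: face_dim_def)
qed

lemma face_dim_le: "face_dim n F \<le> n"
  unfolding face_dim_def by (rule order_trans[OF card_mono[of "{..<n}"]]) auto

lemma face_dim_cube: "face_dim n (cube n) = n"
  unfolding cube_def by (subst face_dim_PiE) auto

lemma face_dim_strict_mono:
  assumes "F \<in> cube_faces n" "G \<in> cube_faces n" "F \<subset> G"
  shows "face_dim n F < face_dim n G"
proof -
  obtain s where s: "F = PiE {..<n} s" "\<And>i. i < n \<Longrightarrow> s i \<in> sides"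
    using assms(1) cube_faceE by metis
  obtain t where t: "G = PiE {..<n} t" "\<And>i. i < n \<Longrightarrow> t i \<in> sides"
    using assms(2) cube_faceE by metis
  have sub: "s i = t i \<or> t i = {0..1}" if "i < n" for i
  proof -
    have "s i \<subseteq> t i"
      using assms(3) that face_subset_iff[of n s t, OF s(2)] unfolding s(1) t(1) by blast
    then show ?thesis using side_subset_iff[OF s(2) t(2), OF that that] by blast
  qed
  have "\<exists>i<n. s i \<noteq> t i"
  proof (rule ccontr)
    assume "\<not> (\<exists>i<n. s i \<noteq> t i)"
    then have "F = G" unfolding s(1) t(1) by (intro PiE_cong) auto
    then show False using assms(3) by blast
  qed
  then have "{i \<in> {..<n}. s i = {0..1}} \<subset> {i \<in> {..<n}. t i = {0..1}}"
    using sub by blast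
  then have "card {i \<in> {..<n}. s i = {0..1}} < card {i \<in> {..<n}. t i = {0..1}}"
    by (intro psubset_card_mono) simp_all
  then show ?thesis
    unfolding s(1) t(1) using face_dim_PiE[of n s, OF s(2)] face_dim_PiE[of n t, OF t(2)] by simp
qed

section \<open>Isomorphisms of face posets\<close>

definition inclusion_isomorphism :: "('a set \<Rightarrow> 'b set) \<Rightarrow> 'a set set \<Rightarrow> 'b set set \<Rightarrow> bool" where
  "inclusion_isomorphism \<phi> P Q \<longleftrightarrow>
     bij_betw \<phi> P Q \<and> (\<forall>\<sigma>\<in>P. \<forall>\<tau>\<in>P. \<sigma> \<subseteq> \<tau> \<longleftrightarrow> \<phi> \<sigma> \<subseteq> \<phi> \<tau>)"

lemma inclusion_isomorphic_iff: "inclusion_isomorphic P Q \<longleftrightarrow> (\<exists>\<phi>. inclusion_isomorphism \<phi> P Q)"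
  unfolding inclusion_isomorphic_def inclusion_isomorphism_def ..

lemma inclusion_isomorphismD:
  assumes "inclusion_isomorphism \<phi> P Q"
  shows "bij_betw \<phi> P Q" "inj_on \<phi> P" "\<phi> ` P = Q"
    "\<sigma> \<in> P \<Longrightarrow> \<tau> \<in> P \<Longrightarrow> \<sigma> \<subseteq> \<tau> \<longleftrightarrow> \<phi> \<sigma> \<subseteq> \<phi> \<tau>"
  using assms by (simp_all add: inclusion_isomorphism_def bij_betw_def)

lemma inclusion_isomorphism_inv:
  assumes "inclusion_isomorphism \<phi> P Q"
  shows "inclusion_isomorphism (inv_into P \<phi>) Q P"
proof -
  note \<phi> = inclusion_isomorphismD[OF assms]
  have inv: "inv_into P \<phi> \<sigma> \<in> P" "\<phi> (inv_into P \<phi> \<sigma>) = \<sigma>" if "\<sigma> \<in> Q" for \<sigma>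
    using that unfolding \<phi>(3)[symmetric] by (rule inv_into_into, rule f_inv_into_f)
  show ?thesis
    unfolding inclusion_isomorphism_def
    using bij_betw_inv_into[OF \<phi>(1)] \<phi>(4) inv by simp
qed

lemma inclusion_isomorphism_comp:
  assumes "inclusion_isomorphism \<phi> P Q" "inclusion_isomorphism \<psi> Q R"
  shows "inclusion_isomorphism (\<psi> \<circ> \<phi>) P R"
proof -
  note \<phi> = inclusion_isomorphismD[OF assms(1)] and \<psi> = inclusion_isomorphismD[OF assms(2)]
  have "\<phi> \<sigma> \<in> Q" if "\<sigma> \<in> P" for \<sigma> using that \<phi>(3) by blast
  then show ?thesis
    unfolding inclusion_isomorphism_def
    using bij_betw_trans[OF \<phi>(1) \<psi>(1)] \<phi>(4) \<psi>(4) by simp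
qed

lemma inclusion_isomorphic_sym: "inclusion_isomorphic P Q \<Longrightarrow> inclusion_isomorphic Q P"
  unfolding inclusion_isomorphic_iff using inclusion_isomorphism_inv by blast

lemma inclusion_isomorphic_trans:
  "inclusion_isomorphic P Q \<Longrightarrow> inclusion_isomorphic Q R \<Longrightarrow> inclusion_isomorphic P R"
  unfolding inclusion_isomorphic_iff using inclusion_isomorphism_comp by blast

lemma inclusion_isomorphism_below:
  assumes "inclusion_isomorphism \<phi> P Q" and \<sigma>: "\<sigma> \<in> P"
  shows "inclusion_isomorphism \<phi> {\<tau>\<in>P. \<tau> \<subseteq> \<sigma>} {\<tau>\<in>Q. \<tau> \<subseteq> \<phi> \<sigma>}"
proof -
  note \<phi> = inclusion_isomorphismD[OF assms(1)]
  have "\<phi> ` {\<tau>\<in>P. \<tau> \<subseteq> \<sigma>} = {\<tau>\<in>Q. \<tau> \<subseteq> \<phi> \<sigma>}"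
    using \<phi>(4)[OF _ \<sigma>] unfolding \<phi>(3)[symmetric] by auto
  moreover have "inj_on \<phi> {\<tau>\<in>P. \<tau> \<subseteq> \<sigma>}"
    by (rule inj_on_subset[OF \<phi>(2)]) simp
  ultimately show ?thesis
    unfolding inclusion_isomorphism_def bij_betw_def using \<phi>(4) by simp
qed

lemma inclusion_isomorphism_empty:
  assumes "inclusion_isomorphism \<phi> P Q" and e: "{} \<in> P" "{} \<in> Q"
  shows "\<phi> {} = {}"
proof -
  note \<phi> = inclusion_isomorphismD[OF assms(1)]
  obtain \<sigma> where "\<sigma> \<in> P" "\<phi> \<sigma> = {}" using e(2) \<phi>(3) by (metis imageE)
  then show ?thesis using \<phi>(4)[OF e(1), of \<sigma>] by simp
qed

text \<open>Forget the coordinates that are constant on the face and renumber the others. The isomorphism is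
  given in the other direction, by images under an injective map \<open>m\<close> of points, so that it respects
  inclusion for free.\<close>

lemma below_face_isomorphic_cube:
  assumes F: "F \<in> cube_faces n"
  shows "inclusion_isomorphic {G \<in> insert {} (cube_faces n). G \<subseteq> F}
           (insert {} (cube_faces (face_dim n F)))"
proof -
  obtain s where s: "F = PiE {..<n} s" "\<And>i. i < n \<Longrightarrow> s i \<in> sides"
    using F cube_faceE by metis
  define A where "A = {i \<in> {..<n}. s i = {0..1}}"
  define j where "j = face_dim n F"
  have "card A = j" unfolding j_def s(1) A_def using face_dim_PiE[OF s(2)] by simp
  moreover have "finite A" by (simp add: A_def)
  ultimately obtain b where b: "bij_betw b {..<j} A"
    using bij_betw_from_nat_into_finite ex_bij_betw_nat_finite lessThan_atLeast0 by metis
  define b' where "b' = inv_into {..<j} b"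
  have bA: "b k \<in> A" "b' (b k) = k" if "k < j" for k
    using b that by (auto simp: b'_def bij_betw_def)
  have b'j: "b' i < j" "b (b' i) = i" if "i \<in> A" for i
    using b that bij_betw_inv_into[OF b] by (auto simp: b'_def bij_betw_inv_into_right dest: bij_betwE)
  \<comment> \<open>The parametrisation of the face by the \<open>j\<close>-cube; outside \<open>A\<close> the coordinate is the constant value.\<close>
  define m :: "(nat \<Rightarrow> real) \<Rightarrow> nat \<Rightarrow> real" where
    "m x = (\<lambda>i\<in>{..<n}. if i \<in> A then x (b' i) else if s i = {0} then 0 else 1)" for x
  have notA: "s i = {if s i = {0} then 0 else 1}" if "i < n" "i \<notin> A" for i
    using that by (cases rule: side_cases[OF s(2)[OF that(1)]]) (simp_all add: A_def)
  have An: "i < n" if "i \<in> A" for i using that by (simp add: A_def)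
  have m_image: "m ` PiE {..<j} t = PiE {..<n} (\<lambda>i. if i \<in> A then t (b' i) else s i)" for t
  proof (intro equalityI subsetI)
    fix y assume "y \<in> m ` PiE {..<j} t"
    then obtain x where x: "x \<in> PiE {..<j} t" "y = m x" by blast
    have "m x i \<in> (if i \<in> A then t (b' i) else s i)" if "i < n" for i
    proof (cases "i \<in> A")
      case True
      then show ?thesis using x(1) b'j(1)[of i] that by (simp add: m_def PiE_iff)
    next
      case False
      have "m x i \<in> {if s i = {0} then 0 else 1}" using False that by (simp add: m_def)
      then show ?thesis using False notA[OF that False] by simp
    qed
    then show "y \<in> PiE {..<n} (\<lambda>i. if i \<in> A then t (b' i) else s i)"
      unfolding x(2) PiE_iff by (simp add: m_def)
  next
    fix y assume y: "y \<in> PiE {..<n} (\<lambda>i. if i \<in> A then t (b' i) else s i)"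
    define x where "x = (\<lambda>k\<in>{..<j}. y (b k))"
    have "x k \<in> t k" if "k < j" for k
    proof -
      have "y (b k) \<in> (if b k \<in> A then t (b' (b k)) else s (b k))"
        using y An bA(1)[OF that] by (intro PiE_mem[OF y]) simp
      then show ?thesis using bA[OF that] that by (simp add: x_def)
    qed
    then have "x \<in> PiE {..<j} t" by (auto simp: x_def)
    moreover have "m x = y"
    proof
      fix i
      show "m x i = y i"
      proof (cases "i < n")
        case True
        then have yi: "y i \<in> (if i \<in> A then t (b' i) else s i)" by (intro PiE_mem[OF y]) simp
        show ?thesis
        proof (cases "i \<in> A")
          case True
          then show ?thesis using \<open>i < n\<close> b'j[of i] by (simp add: m_def x_def)
        next
          case False
          then have "y i \<in> {if s i = {0} then 0 else 1}"
            using yi notA[OF \<open>i < n\<close> False] by simp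
          then show ?thesis using False \<open>i < n\<close> by (simp add: m_def)
        qed
      next
        case False
        then show ?thesis using PiE_arb[OF y, of i] by (simp add: m_def)
      qed
    qed
    ultimately show "y \<in> m ` PiE {..<j} t" by blast
  qed
  have m_inj: "inj_on m (cube j)"
  proof (rule inj_onI)
    fix x y assume xy: "x \<in> cube j" "y \<in> cube j" "m x = m y"
    show "x = y"
    proof (rule PiE_ext[OF xy(1,2)[unfolded cube_def]])
      fix k assume "k \<in> {..<j}"
      then show "x k = y k"
        using fun_cong[OF xy(3), of "b k"] bA[of k] An by (simp add: m_def)
    qed
  qed
  have sub: "G \<subseteq> cube j" if "G \<in> insert {} (cube_faces j)" for G
    using that face_subset_cube by blast
  have order: "G \<subseteq> H \<longleftrightarrow> m ` G \<subseteq> m ` H"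
    if "G \<in> insert {} (cube_faces j)" "H \<in> insert {} (cube_faces j)" for G H
    using inj_on_image_subset_iff[OF m_inj sub[OF that(1)] sub[OF that(2)]] by simp
  have "inj_on ((`) m) (insert {} (cube_faces j))"
    using order by (intro inj_onI) (metis subset_antisym subset_refl)
  moreover have "(`) m ` insert {} (cube_faces j) = {G \<in> insert {} (cube_faces n). G \<subseteq> F}"
  proof (intro equalityI subsetI)
    fix H assume "H \<in> (`) m ` insert {} (cube_faces j)"
    then consider "H = {}" | G where "G \<in> cube_faces j" "H = m ` G" by auto
    then show "H \<in> {G \<in> insert {} (cube_faces n). G \<subseteq> F}"
    proof cases
      case 2
      then obtain t where t: "G = PiE {..<j} t" "\<And>i. i < j \<Longrightarrow> t i \<in> sides"
        using cube_faceE by metis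
      define r where "r = (\<lambda>i. if i \<in> A then t (b' i) else s i)"
      have r: "r i \<in> sides" if "i < n" for i
        using t(2) b'j s(2) that by (simp add: r_def)
      have "r i \<subseteq> s i" if "i < n" for i
        using side_subset_iff[OF r s(2), OF that that] by (auto simp: r_def A_def)
      then have "PiE {..<n} r \<subseteq> F" unfolding s(1) face_subset_iff[OF r] by blast
      moreover have "PiE {..<n} r \<in> cube_faces n" using r by (rule cube_faceI)
      ultimately show ?thesis unfolding 2(2) t(1) m_image r_def by blast
    qed simp
  next
    fix H assume H: "H \<in> {G \<in> insert {} (cube_faces n). G \<subseteq> F}"
    show "H \<in> (`) m ` insert {} (cube_faces j)"
    proof (cases "H = {}")
      case False
      with H have "H \<in> cube_faces n" by blast
      then obtain r where r: "H = PiE {..<n} r" "\<And>i. i < n \<Longrightarrow> r i \<in> sides"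
        using cube_faceE by metis
      have rs: "r i = s i \<or> s i = {0..1}" if "i < n" for i
      proof -
        have "r i \<subseteq> s i"
          using H that face_subset_iff[of n r s, OF r(2)] unfolding r(1) s(1) by blast
        then show ?thesis using side_subset_iff[OF r(2) s(2), OF that that] by blast
      qed
      have "m ` PiE {..<j} (r \<circ> b) = PiE {..<n} (\<lambda>i. if i \<in> A then (r \<circ> b) (b' i) else s i)"
        by (rule m_image)
      also have "\<dots> = H"
        unfolding r(1) using b'j rs by (intro PiE_cong) (auto simp: A_def)
      finally have "H = m ` PiE {..<j} (r \<circ> b)" by simp
      moreover have "PiE {..<j} (r \<circ> b) \<in> cube_faces j"
        using r(2) bA(1) An by (intro cube_faceI) simp
      ultimately show ?thesis by blast
    qed auto
  qed
  ultimately have "inclusion_isomorphic (insert {} (cube_faces j)) {G \<in> insert {} (cube_faces n). G \<subseteq> F}"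
    unfolding inclusion_isomorphic_iff inclusion_isomorphism_def bij_betw_def using order
    by (intro exI[of _ "(`) m"]) simp
  then show ?thesis unfolding j_def by (rule inclusion_isomorphic_sym)
qed

section \<open>Chains of faces with a given largest face\<close>

text \<open>The summand of a face \<open>C\<close> in the \<open>h\<close>-polynomial of a simplicial complex whose largest faces have
  cardinality \<open>N\<close>.\<close>

definition chain_weight :: "nat \<Rightarrow> 'a set \<Rightarrow> real poly" where
  "chain_weight N C = monom 1 (card C) * [:1, - 1:] ^ (N - card C)"

text \<open>The contribution of all chains with a fixed largest face of dimension \<open>d\<close>. The exponent is taken
  relative to the dimension of the ambient complex, so that contributions of faces of different
  dimensions can be added.\<close>

definition top_chain_sum :: "nat \<Rightarrow> nat \<Rightarrow> real poly" where
  "top_chain_sum N d = (\<Sum>C | C \<in> sd (cube_faces d) \<and> cube d \<in> C. chain_weight N C)"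

lemma sd_insert_empty: "sd (insert {} P) = sd P"
  by (simp add: sd_def)

text \<open>The empty set is the least element of both families, hence is preserved, and chains of nonempty sets
  correspond.\<close>

lemma bij_betw_sd:
  assumes "inclusion_isomorphism \<phi> P Q" and e: "{} \<in> P" "{} \<in> Q" and \<sigma>: "\<sigma> \<in> P"
  shows "bij_betw ((`) \<phi>) {C \<in> sd P. \<sigma> \<in> C} {C \<in> sd Q. \<phi> \<sigma> \<in> C}"
proof -
  note \<phi> = inclusion_isomorphismD[OF assms(1)]
  have "\<phi> ` (P - {{}}) = \<phi> ` P - \<phi> ` {{}}"
    using e by (intro inj_on_image_set_diff[OF \<phi>(2)]) auto
  then have ne: "\<phi> ` (P - {{}}) = Q - {{}}"
    by (simp add: \<phi>(3) inclusion_isomorphism_empty[OF assms(1) e])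
  have chain: "(\<forall>\<sigma>\<in>\<phi> ` C. \<forall>\<tau>\<in>\<phi> ` C. \<sigma> \<subseteq> \<tau> \<or> \<tau> \<subseteq> \<sigma>) \<longleftrightarrow> (\<forall>\<sigma>\<in>C. \<forall>\<tau>\<in>C. \<sigma> \<subseteq> \<tau> \<or> \<tau> \<subseteq> \<sigma>)"
    if "C \<subseteq> P" for C
  proof -
    have "\<phi> \<sigma> \<subseteq> \<phi> \<tau> \<longleftrightarrow> \<sigma> \<subseteq> \<tau>" if "\<sigma> \<in> C" "\<tau> \<in> C" for \<sigma> \<tau>
      using \<phi>(4)[of \<sigma> \<tau>] that \<open>C \<subseteq> P\<close> by blast
    then show ?thesis by simp
  qed
  have mem: "\<phi> ` C \<in> sd Q \<and> \<phi> \<sigma> \<in> \<phi> ` C \<longleftrightarrow> C \<in> sd P \<and> \<sigma> \<in> C" if C: "C \<subseteq> P - {{}}" for C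
  proof -
    have "C \<subseteq> P" using C by blast
    then have "\<phi> \<sigma> \<in> \<phi> ` C \<longleftrightarrow> \<sigma> \<in> C"
      using \<sigma> by (intro inj_on_image_mem_iff[OF \<phi>(2)])
    moreover have "\<phi> ` C \<subseteq> Q - {{}}" using C unfolding ne[symmetric] by (rule image_mono)
    ultimately show ?thesis
      using C chain[OF \<open>C \<subseteq> P\<close>] unfolding sd_def mem_Collect_eq by simp
  qed
  have "inj_on ((`) \<phi>) {C \<in> sd P. \<sigma> \<in> C}"
    by (rule inj_on_subset[OF inj_on_image_Pow[OF \<phi>(2)]]) (auto simp: sd_def)
  moreover have "(`) \<phi> ` {C \<in> sd P. \<sigma> \<in> C} = {C \<in> sd Q. \<phi> \<sigma> \<in> C}"
  proof (intro equalityI subsetI)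
    fix D assume "D \<in> (`) \<phi> ` {C \<in> sd P. \<sigma> \<in> C}"
    then obtain C where C: "D = \<phi> ` C" "C \<in> sd P" "\<sigma> \<in> C" by blast
    then have "C \<subseteq> P - {{}}" by (simp add: sd_def)
    then show "D \<in> {C \<in> sd Q. \<phi> \<sigma> \<in> C}" using mem[of C] C by simp
  next
    fix D assume D: "D \<in> {C \<in> sd Q. \<phi> \<sigma> \<in> C}"
    then have "D \<subseteq> \<phi> ` (P - {{}})" unfolding ne by (simp add: sd_def)
    then obtain C where C: "C \<subseteq> P - {{}}" "D = \<phi> ` C" by (rule subset_imageE)
    then have "C \<in> sd P \<and> \<sigma> \<in> C" using mem[OF C(1)] D by simp
    then show "D \<in> (`) \<phi> ` {C \<in> sd P. \<sigma> \<in> C}" using C(2) by blast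
  qed
  ultimately show ?thesis by (simp add: bij_betw_def)
qed

lemma Union_sd_mem:
  assumes "finite P" "C \<in> sd P" "C \<noteq> {}"
  shows "\<Union>C \<in> C"
proof (rule Union_in_chain)
  have "C \<subseteq> P" using assms(2) by (auto simp: sd_def)
  then show "finite C" using assms(1) by (rule finite_subset)
  show "subset.chain (P - {{}}) C" using assms(2) by (simp add: sd_def subset_chain_def)
qed (rule assms(3))

text \<open>The dimension is strictly increasing along a chain and takes values in \<open>{0..d}\<close>.\<close>

lemma sd_cube_card_le:
  assumes "C \<in> sd (cube_faces d)"
  shows "card C \<le> d + 1"
proof -
  have sub: "C \<subseteq> cube_faces d" and chain: "\<And>F G. F \<in> C \<Longrightarrow> G \<in> C \<Longrightarrow> F \<subseteq> G \<or> G \<subseteq> F"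
    using assms by (auto simp: sd_def)
  have "inj_on (face_dim d) C"
  proof (rule inj_onI, rule ccontr)
    fix F G assume FG: "F \<in> C" "G \<in> C" "face_dim d F = face_dim d G" "F \<noteq> G"
    then have "F \<subset> G \<or> G \<subset> F" using chain by blast
    then show False
      using face_dim_strict_mono[of F d G] face_dim_strict_mono[of G d F] sub FG by fastforce
  qed
  then have "card C = card (face_dim d ` C)" by (simp add: card_image)
  also have "\<dots> \<le> card {..d}" using face_dim_le by (intro card_mono) auto
  finally show ?thesis by simp
qed

lemma sd_cube_maximal_chain:
  obtains C where "C \<in> sd (cube_faces d)" "cube d \<in> C" "card C = d + 1"
proof -
  \<comment> \<open>Free the coordinates one after another, starting from the vertex at the origin.\<close>
  define s :: "nat \<Rightarrow> nat \<Rightarrow> real set" where "s k = (\<lambda>i. if i < k then {0..1} else {0})" for k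
  define F where "F k = PiE {..<d} (s k)" for k
  have side: "s k i \<in> sides" for k i by (simp add: s_def)
  have mono: "F k \<subseteq> F l" if "k \<le> l" for k l
    unfolding F_def face_subset_iff[OF side] using that by (auto simp: s_def)
  have dim: "face_dim d (F k) = k" if "k \<le> d" for k
  proof -
    have "{i \<in> {..<d}. s k i = {0..1}} = {..<k}"
      using that by (auto simp: s_def)
    then show ?thesis unfolding F_def face_dim_PiE[OF side] by simp
  qed
  have "inj_on F {..d}" using dim by (intro inj_on_inverseI[of _ "face_dim d"]) auto
  then have "card (F ` {..d}) = d + 1" by (simp add: card_image)
  moreover have "F ` {..d} \<in> sd (cube_faces d)"
  proof -
    have face: "F k \<in> cube_faces d" for k unfolding F_def by (rule cube_faceI) (rule side)
    then have "F ` {..d} \<subseteq> cube_faces d - {{}}"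
      using empty_notin_cube_faces[of d] by (intro image_subsetI) (metis Diff_iff singletonD)
    moreover have "F k \<subseteq> F l \<or> F l \<subseteq> F k" for k l
      using mono nat_le_linear by blast
    ultimately show ?thesis unfolding sd_def by blast
  qed
  moreover have "F d = cube d" unfolding F_def cube_def by (rule PiE_cong) (simp add: s_def)
  then have "cube d \<in> F ` {..d}" by blast
  ultimately show thesis using that by blast
qed

lemma inclusion_isomorphism_cube_top:
  assumes iso: "inclusion_isomorphism \<phi> {\<tau>\<in>P. \<tau> \<subseteq> \<sigma>} (insert {} (cube_faces d))"
    and \<sigma>: "\<sigma> \<in> P"
  shows "\<phi> \<sigma> = cube d"
proof -
  let ?P = "{\<tau>\<in>P. \<tau> \<subseteq> \<sigma>}" and ?Q = "insert {} (cube_faces d)"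
  note \<phi> = inclusion_isomorphismD[OF iso]
  have \<sigma>P: "\<sigma> \<in> ?P" using \<sigma> by simp
  show ?thesis
  proof
    have "cube d \<in> \<phi> ` ?P" unfolding \<phi>(3) using cube_in_cube_faces by simp
    then obtain \<rho> where "\<rho> \<in> ?P" "cube d = \<phi> \<rho>" by (rule imageE)
    then show "cube d \<subseteq> \<phi> \<sigma>" using \<phi>(4)[of \<rho> \<sigma>] \<sigma>P by simp
    have "\<phi> \<sigma> \<in> ?Q" using \<sigma>P \<phi>(3) by blast
    then show "\<phi> \<sigma> \<subseteq> cube d" using face_subset_cube by blast
  qed
qed

text \<open>Chains with largest element \<open>\<sigma>\<close> live below \<open>\<sigma>\<close>, where the family looks like a cube. Since chains
  are finite, \<open>\<Union>C\<close> is the largest element of \<open>C\<close>.\<close>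

lemma chains_below_bij:
  assumes fin: "finite P" and e: "{} \<in> P" and \<sigma>: "\<sigma> \<in> P" "\<sigma> \<noteq> {}"
    and iso: "inclusion_isomorphic {\<tau>\<in>P. \<tau> \<subseteq> \<sigma>} (insert {} (cube_faces d))"
  obtains f where "bij_betw f {C \<in> sd P. C \<noteq> {} \<and> \<Union>C = \<sigma>} {C \<in> sd (cube_faces d). cube d \<in> C}"
    "\<forall>C\<in>{C \<in> sd P. C \<noteq> {} \<and> \<Union>C = \<sigma>}. card (f C) = card C"
proof -
  let ?P = "{\<tau>\<in>P. \<tau> \<subseteq> \<sigma>}" and ?Q = "insert {} (cube_faces d)"
  obtain \<phi> where iso': "inclusion_isomorphism \<phi> ?P ?Q"
    using iso unfolding inclusion_isomorphic_iff by (elim exE)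
  note \<phi> = inclusion_isomorphismD[OF iso']
  have \<sigma>P: "\<sigma> \<in> ?P" using \<sigma> by simp
  have top: "\<phi> \<sigma> = cube d"
    using iso' \<sigma>(1) by (rule inclusion_isomorphism_cube_top)
  have eq: "{C \<in> sd P. C \<noteq> {} \<and> \<Union>C = \<sigma>} = {C \<in> sd ?P. \<sigma> \<in> C}"
  proof (intro equalityI subsetI)
    fix C assume C: "C \<in> {C \<in> sd P. C \<noteq> {} \<and> \<Union>C = \<sigma>}"
    then have "\<Union>C \<in> C" by (intro Union_sd_mem[OF fin]) simp_all
    then show "C \<in> {C \<in> sd ?P. \<sigma> \<in> C}" using C by (auto simp: sd_def)
  next
    fix C assume C: "C \<in> {C \<in> sd ?P. \<sigma> \<in> C}"
    then have "\<Union>C = \<sigma>" by (auto simp: sd_def)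
    then show "C \<in> {C \<in> sd P. C \<noteq> {} \<and> \<Union>C = \<sigma>}" using C by (auto simp: sd_def)
  qed
  have "bij_betw ((`) \<phi>) {C \<in> sd ?P. \<sigma> \<in> C} {C \<in> sd ?Q. \<phi> \<sigma> \<in> C}"
    using e \<sigma>P by (intro bij_betw_sd[OF iso']) simp_all
  then have "bij_betw ((`) \<phi>) {C \<in> sd P. C \<noteq> {} \<and> \<Union>C = \<sigma>} {C \<in> sd (cube_faces d). cube d \<in> C}"
    unfolding eq top sd_insert_empty .
  moreover have "\<forall>C\<in>{C \<in> sd P. C \<noteq> {} \<and> \<Union>C = \<sigma>}. card (\<phi> ` C) = card C"
    unfolding eq by (intro ballI card_image inj_on_subset[OF \<phi>(2)]) (auto simp: sd_def)
  ultimately show thesis by (rule that)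
qed

text \<open>The combinatorial part of the notion of a cubical complex, together with a dimension function: it
  covers both the cubical complex itself, with the topological dimension of its cells, and the face
  complex of the standard cube.\<close>

locale cubical_family =
  fixes P :: "'a set set" and \<delta> :: "'a set \<Rightarrow> nat" and n :: nat
  assumes finite_family: "finite P" and empty_in_family: "{} \<in> P"
    and below_cube: "\<And>\<sigma>. \<sigma> \<in> P \<Longrightarrow> \<sigma> \<noteq> {} \<Longrightarrow>
      inclusion_isomorphic {\<tau>\<in>P. \<tau> \<subseteq> \<sigma>} (insert {} (cube_faces (\<delta> \<sigma>)))"
    and dim_le: "\<And>\<sigma>. \<sigma> \<in> P \<Longrightarrow> \<sigma> \<noteq> {} \<Longrightarrow> \<delta> \<sigma> \<le> n"
    and dim_attained: "\<exists>\<sigma>\<in>P. \<sigma> \<noteq> {} \<and> \<delta> \<sigma> = n"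
begin

lemma finite_sd: "finite (sd P)"
  by (rule finite_subset[of _ "Pow P"]) (auto simp: sd_def finite_family)

lemma Union_chain_in_family:
  assumes "C \<in> sd P" "C \<noteq> {}"
  shows "\<Union>C \<in> P - {{}}"
  using Union_sd_mem[OF finite_family assms] assms(1) unfolding sd_def by blast

lemma Max_card_sd: "Max (card ` sd P) = n + 1"
proof (rule Max_eqI)
  show "finite (card ` sd P)" using finite_sd by simp
  fix k assume "k \<in> card ` sd P"
  then obtain C where C: "C \<in> sd P" "k = card C" by blast
  show "k \<le> n + 1"
  proof (cases "C = {}")
    case False
    have \<sigma>: "\<Union>C \<in> P" "\<Union>C \<noteq> {}" using Union_chain_in_family[OF C(1) False] by auto
    obtain f where bij: "bij_betw f {D \<in> sd P. D \<noteq> {} \<and> \<Union>D = \<Union>C}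
        {D \<in> sd (cube_faces (\<delta> (\<Union>C))). cube (\<delta> (\<Union>C)) \<in> D}"
      and card: "\<forall>D\<in>{D \<in> sd P. D \<noteq> {} \<and> \<Union>D = \<Union>C}. card (f D) = card D"
      using chains_below_bij[OF finite_family empty_in_family \<sigma> below_cube[OF \<sigma>]] .
    have CC: "C \<in> {D \<in> sd P. D \<noteq> {} \<and> \<Union>D = \<Union>C}" using C(1) False by simp
    have "f C \<in> sd (cube_faces (\<delta> (\<Union>C)))" using bij_betwE[OF bij] CC by blast
    then have "card (f C) \<le> \<delta> (\<Union>C) + 1" by (rule sd_cube_card_le)
    moreover have "card (f C) = card C" using card CC by (rule bspec)
    ultimately show ?thesis using C(2) dim_le[OF \<sigma>] by simp
  qed (use C in simp)
next
  obtain \<sigma> where \<sigma>: "\<sigma> \<in> P" "\<sigma> \<noteq> {}" and n: "\<delta> \<sigma> = n" using dim_attained by blast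
  obtain f where bij: "bij_betw f {D \<in> sd P. D \<noteq> {} \<and> \<Union>D = \<sigma>}
        {D \<in> sd (cube_faces (\<delta> \<sigma>)). cube (\<delta> \<sigma>) \<in> D}"
    and card: "\<forall>D\<in>{D \<in> sd P. D \<noteq> {} \<and> \<Union>D = \<sigma>}. card (f D) = card D"
    using chains_below_bij[OF finite_family empty_in_family \<sigma> below_cube[OF \<sigma>]] .
  obtain D where D: "D \<in> sd (cube_faces (\<delta> \<sigma>))" "cube (\<delta> \<sigma>) \<in> D" "card D = n + 1"
    using sd_cube_maximal_chain[of n] n by metis
  then have "D \<in> f ` {D \<in> sd P. D \<noteq> {} \<and> \<Union>D = \<sigma>}" using bij by (simp add: bij_betw_def)
  then obtain C where C: "D = f C" "C \<in> {D \<in> sd P. D \<noteq> {} \<and> \<Union>D = \<sigma>}" by (rule imageE)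
  then have "n + 1 = card C" using card D(3) by simp
  moreover have "C \<in> sd P" using C(2) by simp
  ultimately show "n + 1 \<in> card ` sd P" by (rule image_eqI)
qed

lemma sum_chains_with_top:
  assumes \<sigma>: "\<sigma> \<in> P" "\<sigma> \<noteq> {}"
  shows "(\<Sum>C | C \<in> sd P \<and> C \<noteq> {} \<and> \<Union>C = \<sigma>. chain_weight N C) = top_chain_sum N (\<delta> \<sigma>)"
proof -
  obtain f where bij: "bij_betw f {D \<in> sd P. D \<noteq> {} \<and> \<Union>D = \<sigma>}
        {D \<in> sd (cube_faces (\<delta> \<sigma>)). cube (\<delta> \<sigma>) \<in> D}"
    and card: "\<forall>D\<in>{D \<in> sd P. D \<noteq> {} \<and> \<Union>D = \<sigma>}. card (f D) = card D"
    using chains_below_bij[OF finite_family empty_in_family \<sigma> below_cube[OF \<sigma>]] .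
  have "top_chain_sum N (\<delta> \<sigma>) = (\<Sum>C | C \<in> sd P \<and> C \<noteq> {} \<and> \<Union>C = \<sigma>. chain_weight N (f C))"
    unfolding top_chain_sum_def by (rule sum.reindex_bij_betw[OF bij, symmetric])
  also have "\<dots> = (\<Sum>C | C \<in> sd P \<and> C \<noteq> {} \<and> \<Union>C = \<sigma>. chain_weight N C)"
    using card by (intro sum.cong refl) (simp add: chain_weight_def)
  finally show ?thesis ..
qed

text \<open>The removed chains are those whose largest face satisfies \<open>R\<close>. The hypothesis \<open>R {}\<close> says that the
  empty chain, for which \<open>\<Union>C = {}\<close>, is removed as well.\<close>

lemma h_poly_relative:
  assumes R: "R {}"
  shows "h_poly (sd P) {C \<in> sd P. R (\<Union>C)}
    = (\<Sum>\<sigma> | \<sigma> \<in> P - {{}} \<and> \<not> R \<sigma>. top_chain_sum (n + 1) (\<delta> \<sigma>))"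
proof -
  let ?T = "{\<sigma>. \<sigma> \<in> P - {{}} \<and> \<not> R \<sigma>}"
  let ?S = "{C \<in> sd P. C \<noteq> {} \<and> \<Union>C \<in> ?T}"
  have "C \<in> sd P - {C \<in> sd P. R (\<Union>C)} \<longleftrightarrow> C \<in> ?S" for C
    using R Union_chain_in_family[of C] by (cases "C = {}") auto
  then have "sd P - {C \<in> sd P. R (\<Union>C)} = ?S" unfolding set_eq_iff by (rule allI)
  then have "h_poly (sd P) {C \<in> sd P. R (\<Union>C)} = (\<Sum>C\<in>?S. chain_weight (n + 1) C)"
    unfolding h_poly_def Let_def Max_card_sd chain_weight_def by (rule arg_cong)
  also have "\<dots> = (\<Sum>\<sigma>\<in>?T. \<Sum>C | C \<in> ?S \<and> \<Union>C = \<sigma>. chain_weight (n + 1) C)"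
  proof (rule sum.group[symmetric])
    show "finite ?S" using finite_sd by simp
    show "finite ?T" using finite_family by simp
  qed blast
  also have "\<dots> = (\<Sum>\<sigma>\<in>?T. \<Sum>C | C \<in> sd P \<and> C \<noteq> {} \<and> \<Union>C = \<sigma>. chain_weight (n + 1) C)"
  proof (rule sum.cong[OF refl])
    fix \<sigma> assume "\<sigma> \<in> ?T"
    then have "{C. C \<in> ?S \<and> \<Union>C = \<sigma>} = {C. C \<in> sd P \<and> C \<noteq> {} \<and> \<Union>C = \<sigma>}" by blast
    then show "(\<Sum>C | C \<in> ?S \<and> \<Union>C = \<sigma>. chain_weight (n + 1) C)
        = (\<Sum>C | C \<in> sd P \<and> C \<noteq> {} \<and> \<Union>C = \<sigma>. chain_weight (n + 1) C)"
      by (rule arg_cong)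
  qed
  also have "\<dots> = (\<Sum>\<sigma>\<in>?T. top_chain_sum (n + 1) (\<delta> \<sigma>))"
    by (intro sum.cong refl sum_chains_with_top) simp_all
  finally show ?thesis .
qed

lemma h_poly_absolute:
  "h_poly (sd P) {} = [:1, - 1:] ^ (n + 1) + (\<Sum>\<sigma>\<in>P - {{}}. top_chain_sum (n + 1) (\<delta> \<sigma>))"
proof -
  have "{} \<in> sd P" by (simp add: sd_def)
  then have "h_poly (sd P) {} = chain_weight (n + 1) ({} :: 'a set set)
      + (\<Sum>C\<in>sd P - {{}}. chain_weight (n + 1) C)"
    unfolding h_poly_def Let_def Max_card_sd Diff_empty chain_weight_def[symmetric]
    by (rule sum.remove[OF finite_sd])
  \<comment> \<open>Removing the empty chain alone is the relative case in which only \<open>{}\<close> is excluded.\<close>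
  also have "{{}} = {C \<in> sd P. \<Union>C = {}}"
    by (auto simp: sd_def)
  also have "(\<Sum>C\<in>sd P - {C \<in> sd P. \<Union>C = {}}. chain_weight (n + 1) C)
      = h_poly (sd P) {C \<in> sd P. \<Union>C = {}}"
    unfolding h_poly_def Let_def Max_card_sd chain_weight_def ..
  also have "\<dots> = (\<Sum>\<sigma> | \<sigma> \<in> P - {{}} \<and> \<sigma> \<noteq> {}. top_chain_sum (n + 1) (\<delta> \<sigma>))"
    by (rule h_poly_relative) simp
  also have "{\<sigma>. \<sigma> \<in> P - {{}} \<and> \<sigma> \<noteq> {}} = P - {{}}" by blast
  finally show ?thesis by (simp add: chain_weight_def)
qed

end

lemma cubical_family_cube: "cubical_family (insert {} (cube_faces n)) (face_dim n) n"
proof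
  fix \<sigma> assume "\<sigma> \<in> insert {} (cube_faces n)" "\<sigma> \<noteq> {}"
  then have "\<sigma> \<in> cube_faces n" by simp
  then show "inclusion_isomorphic {\<tau> \<in> insert {} (cube_faces n). \<tau> \<subseteq> \<sigma>}
      (insert {} (cube_faces (face_dim n \<sigma>)))"
    by (rule below_face_isomorphic_cube)
next
  show "\<exists>\<sigma>\<in>insert {} (cube_faces n). \<sigma> \<noteq> {} \<and> face_dim n \<sigma> = n"
  proof (intro bexI conjI)
    show "cube n \<noteq> {}" using cube_in_cube_faces[of n] empty_notin_cube_faces[of n] by metis
  qed (simp_all add: cube_in_cube_faces face_dim_cube)
qed (use finite_cube_faces face_dim_le in auto)

section \<open>Face numbers and the polynomials of the relative subdivided cubes\<close>

text \<open>The face polynomial of a family of faces given by independent choices in the coordinates is the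
  product of the contributions of the coordinates.\<close>

lemma sum_monom_face_dim:
  assumes A: "\<And>i. i < n \<Longrightarrow> A i \<subseteq> sides"
  shows "(\<Sum>F\<in>PiE {..<n} ` PiE {..<n} A. monom 1 (face_dim n F))
    = (\<Prod>i<n. \<Sum>a\<in>A i. if a = {0..1} then monom 1 1 else (1 :: real poly))"
proof -
  have fin: "finite (A i)" if "i < n" for i using finite_subset[OF A[OF that] finite_sides] .
  have sub: "PiE {..<n} A \<subseteq> PiE {..<n} (\<lambda>_. sides)" using A by (intro PiE_mono) auto
  have "(\<Sum>F\<in>PiE {..<n} ` PiE {..<n} A. monom 1 (face_dim n F))
      = (\<Sum>s\<in>PiE {..<n} A. monom (1::real) (face_dim n (PiE {..<n} s)))"
    using inj_on_subset[OF inj_on_face sub] by (simp add: sum.reindex)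
  also have "\<dots> = (\<Sum>s\<in>PiE {..<n} A. \<Prod>i<n. if s i = {0..1} then monom 1 1 else 1)"
  proof (rule sum.cong[OF refl])
    fix s assume "s \<in> PiE {..<n} A"
    then have "s i \<in> sides" if "i < n" for i using A[OF that] that by (auto simp: PiE_iff)
    then have "monom (1::real) (face_dim n (PiE {..<n} s)) = monom 1 1 ^ card {i \<in> {..<n}. s i = {0..1}}"
      by (simp add: face_dim_PiE monom_power)
    also have "\<dots> = (\<Prod>i | i \<in> {..<n} \<and> s i = {0..1}. monom 1 1)" by simp
    also have "\<dots> = (\<Prod>i<n. if s i = {0..1} then monom 1 1 else 1)"
      by (rule prod.inter_filter) simp
    finally show "monom (1::real) (face_dim n (PiE {..<n} s))
        = (\<Prod>i<n. if s i = {0..1} then monom 1 1 else 1)" .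
  qed
  also have "\<dots> = (\<Prod>i<n. \<Sum>a\<in>A i. if a = {0..1} then monom 1 1 else 1)"
    using fin by (intro prod_sum_PiE[symmetric]) auto
  finally show ?thesis .
qed

lemma smult_sum_right: "smult c (\<Sum>x\<in>S. f x) = (\<Sum>x\<in>S. smult c (f x))"
  by (induction S rule: infinite_finite_induct) (simp_all add: smult_add_right)

text \<open>The linear extension of \<open>y^j \<mapsto> top_chain_sum (n + 1) j\<close> to polynomials of degree at most \<open>n\<close>: it
  turns a face polynomial into the \<open>h\<close>-polynomial of the subdivision, up to the empty chain.\<close>

definition subdivided :: "nat \<Rightarrow> real poly \<Rightarrow> real poly" where
  "subdivided n p = (\<Sum>j\<le>n. smult (coeff p j) (top_chain_sum (n + 1) j))"

lemma subdivided_add: "subdivided n (p + q) = subdivided n p + subdivided n q"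
  by (simp add: subdivided_def smult_add_left sum.distrib)

lemma subdivided_smult: "subdivided n (smult c p) = smult c (subdivided n p)"
  unfolding subdivided_def by (simp add: smult_smult[symmetric] smult_sum_right del: smult_smult)

lemma subdivided_sum: "subdivided n (\<Sum>x\<in>S. f x) = (\<Sum>x\<in>S. subdivided n (f x))"
  by (induction S rule: infinite_finite_induct) (simp_all add: subdivided_add, simp_all add: subdivided_def)

lemma subdivided_monom: "k \<le> n \<Longrightarrow> subdivided n (monom 1 k) = top_chain_sum (n + 1) k"
  by (simp add: subdivided_def if_distrib[of "\<lambda>c. smult c _"] cong: if_cong)

lemma sum_top_chain_sum:
  assumes "\<And>\<sigma>. \<sigma> \<in> T \<Longrightarrow> d \<sigma> \<le> n"
  shows "(\<Sum>\<sigma>\<in>T. top_chain_sum (n + 1) (d \<sigma>)) = subdivided n (\<Sum>\<sigma>\<in>T. monom 1 (d \<sigma>))"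
  using assms by (simp add: subdivided_sum subdivided_monom)

lemma sum_sides: "(\<Sum>a\<in>sides. if a = {0..1} then monom 1 1 else 1) = ([:2, 1:] :: real poly)"
  "(\<Sum>a\<in>{{1}, {0..1}}. if a = {0..1::real} then monom 1 1 else 1) = ([:1, 1:] :: real poly)"
  by (auto simp: sides_def monom_altdef numeral_poly one_pCons)

lemma pB_0: "pB n 0 = [:1, - 1:] ^ (n + 1) + subdivided n ([:2, 1:] ^ n)"
proof -
  interpret cubical_family "insert {} (cube_faces n)" "face_dim n" n by (rule cubical_family_cube)
  have "pB n 0 = h_poly (sd (insert {} (cube_faces n))) {}"
    by (simp add: pB_def removed_part_def sd_insert_empty)
  also have "\<dots> = [:1, - 1:] ^ (n + 1) + (\<Sum>F\<in>cube_faces n. top_chain_sum (n + 1) (face_dim n F))"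
    unfolding h_poly_absolute using empty_notin_cube_faces[of n] by simp
  also have "(\<Sum>F\<in>cube_faces n. top_chain_sum (n + 1) (face_dim n F)) = subdivided n ([:2, 1:] ^ n)"
    unfolding sum_top_chain_sum[OF face_dim_le]
    unfolding cube_faces_eq_image by (simp add: sum_monom_face_dim sum_sides del: One_nat_def)
  finally show ?thesis .
qed

lemma face_subset_facet_iff:
  assumes s: "\<And>i. i < n \<Longrightarrow> s i \<in> sides" and i: "i < n" and a: "a \<in> {0, 1}"
  shows "PiE {..<n} s \<subseteq> cube_facet n i a \<longleftrightarrow> s i = {a}"
proof
  assume sub: "PiE {..<n} s \<subseteq> cube_facet n i a"
  have "s i = (\<lambda>x. x i) ` PiE {..<n} s"
    using face_nonempty[of n s, OF s] i unfolding image_projection_PiE by simp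
  also have "\<dots> \<subseteq> {a}" using sub by (auto simp: cube_facet_def)
  finally show "s i = {a}"
    using side_nonempty[OF s[OF i]] by (simp add: subset_singleton_iff)
next
  assume si: "s i = {a}"
  show "PiE {..<n} s \<subseteq> cube_facet n i a"
  proof
    fix x assume x: "x \<in> PiE {..<n} s"
    then have "x i = a" using PiE_mem[OF x, of i] i si by simp
    moreover have "x \<in> cube n" using x face_subset_cube[OF cube_faceI[of n s, OF s]] by blast
    ultimately show "x \<in> cube_facet n i a" by (simp add: cube_facet_def cube_def)
  qed
qed

lemma Union_subset_iff_all: "(\<forall>F\<in>C. F \<subseteq> G) \<longleftrightarrow> \<Union>C \<subseteq> G"
  by blast

lemma prod_three_blocks:
  fixes a b c :: "'a::comm_monoid_mult"
  shows "(\<Prod>i<Suc m + l. if i < m then a else if i = m then b else c) = a ^ m * b * c ^ l"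
  by (induction l) (simp_all add: ac_simps)

text \<open>Surviving faces have \<open>[0,1]\<close> as their factor in the first \<open>k - 1\<close> coordinates, a factor other than
  \<open>{0}\<close> in the next coordinate, and no condition in the last \<open>n - k\<close> coordinates.\<close>

lemma pB_middle:
  assumes k: "1 \<le> k" "k \<le> n"
  shows "pB n k = smult 2 (subdivided n (monom 1 (k - 1) * [:1, 1:] * [:2, 1:] ^ (n - k)))"
proof -
  interpret cubical_family "insert {} (cube_faces n)" "face_dim n" n by (rule cubical_family_cube)
  define A :: "nat \<Rightarrow> real set set" where
    "A i = (if i < k - 1 then {{0..1}} else if i = k - 1 then {{1}, {0..1}} else sides)" for i
  define T where "T = PiE {..<n} ` PiE {..<n} A"
  have A_sides: "A i \<subseteq> sides" for i by (simp add: A_def)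
  have T_sub: "T \<subseteq> cube_faces n"
    unfolding T_def cube_faces_eq_image by (intro image_mono PiE_mono A_sides)
  have T_iff: "F \<in> T \<longleftrightarrow> \<not> (\<exists>G\<in>removed_facets n k. F \<subseteq> G)" if F: "F \<in> cube_faces n" for F
  proof -
    obtain s where s: "F = PiE {..<n} s" "s \<in> PiE {..<n} (\<lambda>_. sides)"
      using F unfolding cube_faces_eq_image by blast
    then have side: "s i \<in> sides" if "i < n" for i using that by (auto simp: PiE_iff)
    have "F \<in> T \<longleftrightarrow> s \<in> PiE {..<n} A"
    proof
      assume "F \<in> T"
      then obtain t where t: "t \<in> PiE {..<n} A" "F = PiE {..<n} t" by (auto simp: T_def)
      then have "t \<in> PiE {..<n} (\<lambda>_. sides)" using A_sides by (auto simp: PiE_iff)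
      then show "s \<in> PiE {..<n} A" using inj_onD[OF inj_on_face, of n s t] s t by auto
    qed (simp add: T_def s(1))
    also have "\<dots> \<longleftrightarrow> (\<forall>i<n. s i \<in> A i)" using s(2) by (auto simp: PiE_iff)
    also have "\<dots> \<longleftrightarrow> (\<forall>i<k - 1. s i \<noteq> {0} \<and> s i \<noteq> {1}) \<and> s (k - 1) \<noteq> {0}"
    proof (intro iffI conjI allI impI)
      assume all: "\<forall>i<n. s i \<in> A i"
      show "s i \<noteq> {0}" "s i \<noteq> {1}" if "i < k - 1" for i
        using all[rule_format, of i] that k by (simp_all add: A_def)
      have "s (k - 1) \<in> {{1}, {0..1}}"
        using all[rule_format, of "k - 1"] k by (simp add: A_def)
      then show "s (k - 1) \<noteq> {0}" by (elim insertE) simp_all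
    next
      fix i assume c: "(\<forall>i<k - 1. s i \<noteq> {0} \<and> s i \<noteq> {1}) \<and> s (k - 1) \<noteq> {0}" and i: "i < n"
      then show "s i \<in> A i"
        by (cases rule: side_cases[OF side[OF i]]) (auto simp: A_def)
    qed
    also have "\<dots> \<longleftrightarrow> \<not> (\<exists>G\<in>removed_facets n k. F \<subseteq> G)"
    proof -
      have facet: "F \<subseteq> cube_facet n i a \<longleftrightarrow> s i = {a}" if "i \<le> k - 1" "a \<in> {0, 1}" for i a
        unfolding s(1) using that k by (intro face_subset_facet_iff side) auto
      have "(\<exists>G\<in>removed_facets n k. F \<subseteq> G) \<longleftrightarrow>
          (\<exists>i<k - 1. F \<subseteq> cube_facet n i 0 \<or> F \<subseteq> cube_facet n i 1) \<or> F \<subseteq> cube_facet n (k - 1) 0"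
        unfolding removed_facets_def by blast
      also have "\<dots> \<longleftrightarrow> (\<exists>i<k - 1. s i = {0} \<or> s i = {1}) \<or> s (k - 1) = {0}"
        using facet by (simp cong: conj_cong)
      finally show ?thesis by blast
    qed
    finally show ?thesis .
  qed
  have removed: "removed_part n k = {C \<in> sd (insert {} (cube_faces n)). \<exists>G\<in>removed_facets n k. \<Union>C \<subseteq> G}"
    using k by (simp add: removed_part_def sd_insert_empty Union_subset_iff_all)
  have T_eq: "{\<sigma>. \<sigma> \<in> insert {} (cube_faces n) - {{}} \<and> \<not> (\<exists>G\<in>removed_facets n k. \<sigma> \<subseteq> G)} = T"
    using T_iff T_sub empty_notin_cube_faces[of n] by blast
  have "h_poly (sd (cube_faces n)) (removed_part n k)
      = h_poly (sd (insert {} (cube_faces n)))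
          {C \<in> sd (insert {} (cube_faces n)). \<exists>G\<in>removed_facets n k. \<Union>C \<subseteq> G}"
    unfolding removed sd_insert_empty ..
  also have "\<dots> = (\<Sum>F\<in>T. top_chain_sum (n + 1) (face_dim n F))"
    unfolding T_eq[symmetric] by (rule h_poly_relative) (auto simp: removed_facets_def)
  also have "\<dots> = subdivided n (\<Sum>F\<in>T. monom 1 (face_dim n F))"
    by (rule sum_top_chain_sum) (rule face_dim_le)
  also have "(\<Sum>F\<in>T. monom 1 (face_dim n F))
      = (\<Prod>i<n. \<Sum>a\<in>A i. if a = {0..1} then monom 1 1 else (1 :: real poly))"
    unfolding T_def by (rule sum_monom_face_dim) (rule A_sides)
  also have "\<dots> = (\<Prod>i<Suc (k - 1) + (n - k).
      if i < k - 1 then monom 1 1 else if i = k - 1 then [:1, 1:] else [:2, 1:])"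
    using k by (intro prod.cong) (simp_all add: A_def sum_sides del: One_nat_def)
  also have "\<dots> = monom 1 (k - 1) * [:1, 1:] * [:2, 1:] ^ (n - k)"
    by (simp only: prod_three_blocks monom_power power_one mult_1)
  finally show ?thesis using k by (simp add: pB_def)
qed

text \<open>A proper face lies in a facet, and the centre of the cube is not on the boundary; so only the cube
  itself survives. This includes \<open>n = 0\<close>, where the boundary is empty and the only face is a point.\<close>

lemma pB_top: "pB n (n + 1) = subdivided n (monom 1 n)"
proof -
  interpret cubical_family "insert {} (cube_faces n)" "face_dim n" n by (rule cubical_family_cube)
  have iff: "F \<subseteq> cube_boundary n \<longleftrightarrow> F \<noteq> cube n" if F: "F \<in> cube_faces n" for F
  proof -
    obtain s where s: "F = PiE {..<n} s" "\<And>i. i < n \<Longrightarrow> s i \<in> sides"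
      using F cube_faceE by metis
    show ?thesis
    proof
      assume sub: "F \<subseteq> cube_boundary n"
      have "(\<lambda>i\<in>{..<n}. 1/2) \<in> cube n" by (auto simp: cube_def)
      moreover have "(\<lambda>i\<in>{..<n}. 1/2) \<notin> cube_boundary n"
        by (auto simp: cube_boundary_def cube_facet_def)
      ultimately show "F \<noteq> cube n" using sub by blast
    next
      assume "F \<noteq> cube n"
      then obtain i where i: "i < n" "s i \<noteq> {0..1}"
        unfolding s(1) cube_def by (metis PiE_cong lessThan_iff)
      then obtain a where a: "s i = {a}" "a \<in> {0, 1}"
        by (cases rule: side_cases[OF s(2)[OF i(1)]]) auto
      then have "F \<subseteq> cube_facet n i a"
        unfolding s(1) using face_subset_facet_iff[OF s(2) i(1) a(2)] by simp
      then show "F \<subseteq> cube_boundary n" using i a unfolding cube_boundary_def by blast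
    qed
  qed
  have cond: "\<sigma> \<in> insert {} (cube_faces n) - {{}} \<and> \<not> \<sigma> \<subseteq> cube_boundary n \<longleftrightarrow> \<sigma> \<in> {cube n}" for \<sigma>
    using iff[of \<sigma>] cube_in_cube_faces[of n] empty_notin_cube_faces[of n] by auto
  have "pB n (n + 1) = h_poly (sd (insert {} (cube_faces n)))
      {C \<in> sd (insert {} (cube_faces n)). \<Union>C \<subseteq> cube_boundary n}"
    by (simp add: pB_def removed_part_def sd_insert_empty Union_subset_iff_all)
  also have "\<dots> = (\<Sum>F | F \<in> insert {} (cube_faces n) - {{}} \<and> \<not> F \<subseteq> cube_boundary n.
      top_chain_sum (n + 1) (face_dim n F))"
    by (rule h_poly_relative) simp
  also have "\<dots> = (\<Sum>F\<in>{cube n}. top_chain_sum (n + 1) (face_dim n F))"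
    unfolding cond by simp
  also have "\<dots> = subdivided n (monom 1 n)" by (simp add: face_dim_cube subdivided_monom)
  finally show ?thesis .
qed

section \<open>Topological and combinatorial dimension of a cubical complex\<close>

lemma facet_below_cube:
  "\<exists>F\<in>cube_faces (Suc d). F \<noteq> cube (Suc d) \<and> face_dim (Suc d) F = d"
proof -
  define s :: "nat \<Rightarrow> real set" where "s i = (if i < d then {0..1} else {0})" for i
  have side: "s i \<in> sides" for i by (simp add: s_def)
  have "{i \<in> {..<Suc d}. s i = {0..1}} = {..<d}" by (auto simp: s_def)
  then have dim: "face_dim (Suc d) (PiE {..<Suc d} s) = d"
    by (simp add: face_dim_PiE[of "Suc d" s, OF side])
  have "PiE {..<Suc d} s \<noteq> cube (Suc d)"
  proof
    assume "PiE {..<Suc d} s = cube (Suc d)"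
    then show False using dim face_dim_cube[of "Suc d"] by simp
  qed
  then show ?thesis
    using dim cube_faceI[of "Suc d" s, OF side] by (intro bexI[of _ "PiE {..<Suc d} s"] conjI)
qed

text \<open>Induction on the dimension of the cube. By induction the proper faces of the cell have the
  dimensions of the proper faces of the \<open>d\<close>-cube, whose maximum is \<open>d - 1\<close> if \<open>d > 0\<close>, while there are
  none if \<open>d = 0\<close>. Strict monotonicity of the dimension gives one inequality, the existence of a face
  of codimension one the other.\<close>

lemma cell_dim_cubical:
  assumes cx: "cubical_complex X L"
  shows "\<sigma> \<in> L \<Longrightarrow> \<sigma> \<noteq> {} \<Longrightarrow> inclusion_isomorphic {\<tau>\<in>L. \<tau> \<subseteq> \<sigma>} (insert {} (cube_faces d)) \<Longrightarrow>
    cell_dim X \<sigma> = d"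
proof (induction d arbitrary: \<sigma> rule: less_induct)
  case (less d)
  have L: "regular_cell_complex X L" using cx unfolding cubical_complex_def by (elim conjE)
  let ?P = "{\<tau>\<in>L. \<tau> \<subseteq> \<sigma>}" and ?Q = "insert {} (cube_faces d)"
  obtain \<phi> where iso: "inclusion_isomorphism \<phi> ?P ?Q"
    using less.prems(3) unfolding inclusion_isomorphic_iff by (elim exE)
  note \<phi> = inclusion_isomorphismD[OF iso]
  have \<sigma>P: "\<sigma> \<in> ?P" using less.prems(1) by simp
  have eP: "{} \<in> ?P" using L unfolding regular_cell_complex_def by simp
  have \<phi>0: "\<phi> {} = {}" using eP by (rule inclusion_isomorphism_empty[OF iso]) simp
  have \<phi>\<sigma>: "\<phi> \<sigma> = cube d"
    using iso less.prems(1) by (rule inclusion_isomorphism_cube_top)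
  have proper: "cell_dim X \<tau> = face_dim d (\<phi> \<tau>)" "cell_dim X \<tau> < d"
    if \<tau>: "\<tau> \<in> L" "\<tau> \<noteq> {}" "\<tau> \<subset> \<sigma>" for \<tau>
  proof -
    have \<tau>P: "\<tau> \<in> ?P" using \<tau> by blast
    have "\<phi> \<tau> \<noteq> {}" using inj_onD[OF \<phi>(2), of \<tau> "{}"] \<tau>P eP \<phi>0 \<tau>(2) by auto
    moreover have "\<phi> \<tau> \<in> ?Q" using \<tau>P \<phi>(3) by blast
    ultimately have face: "\<phi> \<tau> \<in> cube_faces d" by simp
    have "\<phi> \<tau> \<subseteq> \<phi> \<sigma>" using \<phi>(4)[OF \<tau>P \<sigma>P] \<tau>(3) by blast
    moreover have "\<phi> \<tau> \<noteq> \<phi> \<sigma>" using inj_onD[OF \<phi>(2), of \<tau> \<sigma>] \<tau>P \<sigma>P \<tau>(3) by auto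
    ultimately have "\<phi> \<tau> \<subset> cube d" unfolding \<phi>\<sigma> by blast
    then have lt: "face_dim d (\<phi> \<tau>) < d"
      using face_dim_strict_mono[OF face cube_in_cube_faces] face_dim_cube[of d] by simp
    have "{\<rho> \<in> ?P. \<rho> \<subseteq> \<tau>} = {\<rho>\<in>L. \<rho> \<subseteq> \<tau>}" using \<tau>(3) by blast
    then have "inclusion_isomorphic {\<rho>\<in>L. \<rho> \<subseteq> \<tau>} {G \<in> ?Q. G \<subseteq> \<phi> \<tau>}"
      using inclusion_isomorphism_below[OF iso \<tau>P] unfolding inclusion_isomorphic_iff by metis
    then have "inclusion_isomorphic {\<rho>\<in>L. \<rho> \<subseteq> \<tau>} (insert {} (cube_faces (face_dim d (\<phi> \<tau>))))"
      using below_face_isomorphic_cube[OF face] by (rule inclusion_isomorphic_trans)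
    then show "cell_dim X \<tau> = face_dim d (\<phi> \<tau>)"
      using less.IH[OF lt \<tau>(1,2)] by simp
    then show "cell_dim X \<tau> < d" using lt by simp
  qed
  have upper: "cell_dim X \<sigma> \<le> d"
  proof (cases "cell_dim X \<sigma>")
    case (Suc D)
    then obtain \<tau> where \<tau>: "\<tau> \<in> L" "\<tau> \<noteq> {}" "\<tau> \<subset> \<sigma>" and D: "cell_dim X \<tau> = D"
      using cell_has_facet[OF L less.prems(1,2)] by metis
    then show ?thesis using proper(2)[OF \<tau>] Suc by simp
  qed simp
  have lower: "d \<le> cell_dim X \<sigma>"
  proof (cases d)
    case (Suc e)
    obtain F where F: "F \<in> cube_faces d" "F \<noteq> cube d" "face_dim d F = e"
      using facet_below_cube[of e] unfolding Suc by blast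
    then have "F \<in> \<phi> ` ?P" unfolding \<phi>(3) by simp
    then obtain \<tau> where \<tau>P: "\<tau> \<in> ?P" and F\<tau>: "F = \<phi> \<tau>" by (rule imageE)
    have "\<tau> \<noteq> {}" using F(1) F\<tau> \<phi>0 empty_notin_cube_faces[of d] by metis
    moreover have "\<tau> \<noteq> \<sigma>" using F(2) F\<tau> \<phi>\<sigma> by metis
    ultimately have \<tau>: "\<tau> \<in> L" "\<tau> \<noteq> {}" "\<tau> \<subset> \<sigma>" using \<tau>P by auto
    have "cell_dim X \<tau> = e" using proper(1)[OF \<tau>] F(3) F\<tau> by simp
    then show ?thesis
      using cell_dim_strict_mono[OF L \<tau>(1,2) less.prems(1) \<tau>(3)] Suc by simp
  qed simp
  show ?case using upper lower by simp
qed

lemma cubical_family_complex: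
  assumes cx: "cubical_complex X L" and ne: "L - {{}} \<noteq> {}"
  shows "cubical_family L (cell_dim X) (complex_dim X L)"
proof -
  have L: "regular_cell_complex X L" using cx unfolding cubical_complex_def by (elim conjE)
  have fin: "finite L" using finite_cell_complex[OF L] .
  have Max: "finite (cell_dim X ` (L - {{}}))" "cell_dim X ` (L - {{}}) \<noteq> {}"
    using fin ne by simp_all
  show ?thesis
  proof
    show "finite L" by (rule fin)
    show "{} \<in> L" using L unfolding regular_cell_complex_def by simp
    show "inclusion_isomorphic {\<tau>\<in>L. \<tau> \<subseteq> \<sigma>} (insert {} (cube_faces (cell_dim X \<sigma>)))"
      if "\<sigma> \<in> L" "\<sigma> \<noteq> {}" for \<sigma>
    proof -
      have "\<forall>\<sigma>\<in>L - {{}}. \<exists>d. inclusion_isomorphic {\<tau>\<in>L. \<tau> \<subseteq> \<sigma>} (insert {} (cube_faces d))"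
        using cx unfolding cubical_complex_def by (elim conjE)
      moreover have "\<sigma> \<in> L - {{}}" using that by simp
      ultimately have "\<exists>d. inclusion_isomorphic {\<tau>\<in>L. \<tau> \<subseteq> \<sigma>} (insert {} (cube_faces d))" by (rule bspec)
      then obtain d where d: "inclusion_isomorphic {\<tau>\<in>L. \<tau> \<subseteq> \<sigma>} (insert {} (cube_faces d))" by (elim exE)
      then show ?thesis using cell_dim_cubical[OF cx that d] by simp
    qed
    show "cell_dim X \<sigma> \<le> complex_dim X L" if "\<sigma> \<in> L" "\<sigma> \<noteq> {}" for \<sigma>
      unfolding complex_dim_def using that by (intro Max_ge[OF Max(1)]) simp
    show "\<exists>\<sigma>\<in>L. \<sigma> \<noteq> {} \<and> cell_dim X \<sigma> = complex_dim X L"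
    proof -
      have "complex_dim X L \<in> cell_dim X ` (L - {{}})"
        unfolding complex_dim_def using Max by (rule Max_in)
      then obtain \<sigma> where "complex_dim X L = cell_dim X \<sigma>" "\<sigma> \<in> L - {{}}" by (rule imageE)
      then show ?thesis by (intro bexI[of _ \<sigma>]) simp_all
    qed
  qed
qed

section \<open>Face numbers and the cubical h-vector\<close>

lemma degree_f_term_le:
  assumes "k \<le> n"
  shows "degree (monom (1::real) (k + 1) * [:1/2, - 1/2:] ^ (n - k)) \<le> n + 1"
proof -
  have "degree (monom (1::real) (k + 1) * [:1/2, - 1/2:] ^ (n - k)) \<le> (k + 1) + 1 * (n - k)"
    by (intro degree_mult_le[THEN order_trans] add_mono degree_monom_le
        degree_power_le[THEN order_trans] mult_mono) auto
  then show ?thesis using assms by simp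
qed

text \<open>All terms of the numerator except the one with the Euler characteristic have degree at most
  \<open>n + 1\<close>. Comparing the coefficients of \<open>x^(n+2)\<close> therefore gives \<open>h_(n+1)\<close>.\<close>

lemma cubical_h_poly_top:
  assumes "complex_dim X L = n"
  shows "degree (cubical_h_poly X L) \<le> n + 1"
    and "cubical_h X L (n + 1) = (- 1) ^ n * of_int (reduced_euler X L)"
proof -
  let ?c = "(- 1 :: real) ^ n * of_int (reduced_euler X L)"
  define q where "q = (1 :: real poly)
    + (\<Sum>k=0..n. smult (real (f_num X L k)) (monom 1 (k + 1) * [:1/2, - 1/2:] ^ (n - k)))"
  have q: "degree q \<le> n + 1"
    unfolding q_def
    by (intro degree_add_le degree_sum_le order_trans[OF degree_smult_le] degree_f_term_le) simp_all
  have num: "cubical_h_numerator X L = q + monom ?c (n + 2)"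
    unfolding cubical_h_numerator_def Let_def assms q_def ..
  have "degree (cubical_h_numerator X L) \<le> n + 2"
    unfolding num using q by (intro degree_add_le degree_monom_le) simp
  show deg: "degree (cubical_h_poly X L) \<le> n + 1"
  proof (cases "cubical_h_poly X L = 0")
    case False
    then have "degree (cubical_h_numerator X L) = 1 + degree (cubical_h_poly X L)"
      unfolding cubical_h_poly_eq[symmetric] by (subst degree_mult_eq) simp_all
    then show ?thesis using \<open>degree (cubical_h_numerator X L) \<le> n + 2\<close> by simp
  qed simp
  have "coeff ([:1, 1:] * cubical_h_poly X L) (n + 2) = ?c"
    unfolding cubical_h_poly_eq num using q by (simp add: coeff_eq_0)
  moreover have "coeff ([:1, 1:] * cubical_h_poly X L) (n + 2)
      = coeff (cubical_h_poly X L) (n + 2) + coeff (cubical_h_poly X L) (n + 1)"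
    by (simp add: coeff_pCons)
  moreover have "coeff (cubical_h_poly X L) (n + 2) = 0" using deg by (simp add: coeff_eq_0)
  ultimately show "cubical_h X L (n + 1) = ?c" by (simp add: cubical_h_def)
qed

lemma cubical_h_0: "cubical_h X L 0 = 1"
proof -
  have "coeff ([:1, 1:] * cubical_h_poly X L) 0 = 1"
    unfolding cubical_h_poly_eq cubical_h_numerator_def Let_def
    by (simp add: coeff_sum coeff_mult_0 coeff_monom)
  then show ?thesis by (simp add: cubical_h_def)
qed

text \<open>Evaluate the defining equation of the cubical \<open>h\<close>-polynomial at \<open>x = y / z\<close> with \<open>z = 2 + y\<close> and
  multiply by \<open>z^(n+1)\<close>. Only the terms with \<open>h_(n+1)\<close> keep a denominator, and they combine to a
  polynomial because \<open>(z + y) / z - y / z = 1\<close>. What remains is \<open>y\<close> times the claim. The identity for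
  all \<open>y > 0\<close> implies the identity of polynomials.\<close>

lemma f_polynomial_eq:
  assumes n: "complex_dim X L = n"
  shows "(\<Sum>k=0..n. smult (real (f_num X L k)) (monom 1 k))
    = [:2, 1:] ^ n
      + (\<Sum>k=1..n. smult (2 * cubical_h X L k) (monom 1 (k - 1) * [:1, 1:] * [:2, 1:] ^ (n - k)))
      + smult (cubical_h X L (n + 1)) (monom 1 n)" (is "?lhs = ?rhs")
proof -
  let ?h = "cubical_h X L" and ?f = "\<lambda>k. real (f_num X L k)"
  have "poly ?lhs y = poly ?rhs y" if y: "y > 0" for y :: real
  proof -
    define z where "z = 2 + y"
    have z: "z > 0" using y by (simp add: z_def)
    have zy: "(z - y) / 2 = 1" by (simp add: z_def)
    have h_eval: "poly (cubical_h_poly X L) (y / z) = (\<Sum>k=0..n + 1. ?h k * (y / z) ^ k)"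
    proof -
      have "poly (cubical_h_poly X L) (y / z)
          = (\<Sum>k\<le>degree (cubical_h_poly X L). ?h k * (y / z) ^ k)"
        unfolding cubical_h_def by (rule poly_altdef)
      also have "\<dots> = (\<Sum>k=0..n + 1. ?h k * (y / z) ^ k)"
        using cubical_h_poly_top(1)[OF n]
        by (intro sum.mono_neutral_left) (auto simp: cubical_h_def coeff_eq_0)
      finally show ?thesis .
    qed
    have num_eval: "poly (cubical_h_numerator X L) (y / z)
        = 1 + (\<Sum>k=0..n. ?f k * ((y / z) ^ (k + 1) * (1 / z) ^ (n - k))) + ?h (n + 1) * (y / z) ^ (n + 2)"
    proof -
      have "poly [:1/2, - 1/2:] (y / z) = 1 / z"
        using z by (simp add: z_def field_simps)
      then show ?thesis
        unfolding cubical_h_numerator_def Let_def n cubical_h_poly_top(2)[OF n]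
        by (simp add: poly_sum poly_monom)
    qed
    have "(1 + y / z) * (\<Sum>k=0..n + 1. ?h k * (y / z) ^ k)
        = 1 + (\<Sum>k=0..n. ?f k * ((y / z) ^ (k + 1) * (1 / z) ^ (n - k))) + ?h (n + 1) * (y / z) ^ (n + 2)"
      using arg_cong[OF cubical_h_poly_eq[of X L], of "\<lambda>p. poly p (y / z)"]
      unfolding poly_mult h_eval num_eval by simp
    then have eq: "z ^ (n + 1) * ((1 + y / z) * (\<Sum>k=0..n + 1. ?h k * (y / z) ^ k))
        = z ^ (n + 1) * (1 + (\<Sum>k=0..n. ?f k * ((y / z) ^ (k + 1) * (1 / z) ^ (n - k)))
          + ?h (n + 1) * (y / z) ^ (n + 2))" by (rule arg_cong)
    have lhs: "z ^ (n + 1) * ((1 + y / z) * (\<Sum>k=0..n + 1. ?h k * (y / z) ^ k))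
        = (z + y) * (\<Sum>k=0..n. ?h k * (y ^ k * z ^ (n - k))) + (z + y) * ?h (n + 1) * y ^ (n + 1) / z"
    proof -
      have "z ^ n * (y / z) ^ k = y ^ k * z ^ (n - k)" if "k \<le> n" for k
        using z that by (simp add: power_divide power_diff)
      then have "z ^ n * (\<Sum>k=0..n. ?h k * (y / z) ^ k) = (\<Sum>k=0..n. ?h k * (y ^ k * z ^ (n - k)))"
        unfolding sum_distrib_left by (intro sum.cong) (simp_all add: mult.left_commute)
      moreover have "z * (1 + y / z) = z + y" using z by (simp add: field_simps)
      moreover have "z ^ n * (y / z) ^ (n + 1) = y ^ (n + 1) / z"
        using z by (simp add: power_divide)
      moreover have "z ^ (n + 1) * ((1 + y / z) * (\<Sum>k=0..n + 1. ?h k * (y / z) ^ k))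
          = (z * (1 + y / z)) * (z ^ n * (\<Sum>k=0..n. ?h k * (y / z) ^ k))
            + (z * (1 + y / z)) * ?h (n + 1) * (z ^ n * (y / z) ^ (n + 1))"
      proof -
        have "z ^ (n + 1) * (a * (b + c * d)) = (z * a) * (z ^ n * b) + (z * a) * c * (z ^ n * d)"
          for a b c d :: real by (simp add: algebra_simps)
        moreover have "(\<Sum>k=0..n + 1. ?h k * (y / z) ^ k)
            = (\<Sum>k=0..n. ?h k * (y / z) ^ k) + ?h (n + 1) * (y / z) ^ (n + 1)" by simp
        ultimately show ?thesis by (simp only:)
      qed
      ultimately show ?thesis by (simp only: times_divide_eq_right)
    qed
    have rhs: "z ^ (n + 1) * (1 + (\<Sum>k=0..n. ?f k * ((y / z) ^ (k + 1) * (1 / z) ^ (n - k)))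
          + ?h (n + 1) * (y / z) ^ (n + 2))
        = z ^ (n + 1) + y * (\<Sum>k=0..n. ?f k * y ^ k) + ?h (n + 1) * y ^ (n + 2) / z"
    proof -
      have clear: "z ^ (n + 1) * ((y / z) ^ (k + 1) * (1 / z) ^ (n - k)) = y * y ^ k" if "k \<le> n" for k
      proof -
        have "(y / z) ^ (k + 1) * (1 / z) ^ (n - k) = y ^ (k + 1) / z ^ ((k + 1) + (n - k))"
          by (simp add: power_divide power_add)
        also have "(k + 1) + (n - k) = n + 1" using that by simp
        finally show ?thesis using z by simp
      qed
      have "z ^ (n + 1) * (\<Sum>k=0..n. ?f k * ((y / z) ^ (k + 1) * (1 / z) ^ (n - k)))
          = y * (\<Sum>k=0..n. ?f k * y ^ k)"
        unfolding sum_distrib_left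
      proof (rule sum.cong[OF refl])
        fix k assume "k \<in> {0..n}"
        then have "?f k * (z ^ (n + 1) * ((y / z) ^ (k + 1) * (1 / z) ^ (n - k))) = ?f k * (y * y ^ k)"
          by (subst clear) simp_all
        then show "z ^ (n + 1) * (?f k * ((y / z) ^ (k + 1) * (1 / z) ^ (n - k))) = y * (?f k * y ^ k)"
          by (simp only: mult.left_commute)
      qed
      moreover have "z ^ (n + 1) * (y / z) ^ (n + 2) = y ^ (n + 2) / z"
        using z by (simp add: power_divide)
      ultimately show ?thesis
        by (simp only: distrib_left mult_1_right mult.left_commute[of _ "?h (n + 1)"] times_divide_eq_right)
    qed
    have split_0: "(\<Sum>k=0..n. ?h k * (y ^ k * z ^ (n - k)))
        = z ^ n + y * (\<Sum>k=1..n. ?h k * (y ^ (k - 1) * z ^ (n - k)))"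
    proof -
      have "(\<Sum>k=1..n. ?h k * (y ^ k * z ^ (n - k))) = y * (\<Sum>k=1..n. ?h k * (y ^ (k - 1) * z ^ (n - k)))"
        unfolding sum_distrib_left
        by (intro sum.cong refl) (auto simp: power_eq_if)
      then show ?thesis by (simp add: sum.atLeast_Suc_atMost cubical_h_0)
    qed
    have "y * (\<Sum>k=0..n. ?f k * y ^ k)
        = y * (z ^ n + (z + y) * (\<Sum>k=1..n. ?h k * (y ^ (k - 1) * z ^ (n - k))) + ?h (n + 1) * y ^ n)"
    proof -
      have combine: "y * a = y * (z ^ n + (z + y) * b + c * y ^ n)"
        if "(z + y) * (z ^ n + y * b) + (z + y) * c * y ^ (n + 1) / z
            = z ^ (n + 1) + y * a + c * y ^ (n + 2) / z" for a b c
      proof -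
        have "(z + y) * c * y ^ (n + 1) / z = c * y ^ (n + 1) + c * y ^ (n + 2) / z"
          using z by (simp add: field_simps)
        moreover have "(z + y) * (z ^ n + y * b) = z ^ (n + 1) + y * (z ^ n + (z + y) * b)"
          by (simp add: algebra_simps)
        ultimately have "y * a = y * (z ^ n + (z + y) * b) + c * y ^ (n + 1)" using that by linarith
        then show ?thesis by (simp add: algebra_simps)
      qed
      show ?thesis by (rule combine) (rule eq[unfolded lhs rhs split_0])
    qed
    then have "(\<Sum>k=0..n. ?f k * y ^ k)
        = z ^ n + (z + y) * (\<Sum>k=1..n. ?h k * (y ^ (k - 1) * z ^ (n - k))) + ?h (n + 1) * y ^ n"
      using y by simp
    also have "(z + y) * (\<Sum>k=1..n. ?h k * (y ^ (k - 1) * z ^ (n - k)))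
        = (\<Sum>k=1..n. 2 * ?h k * (y ^ (k - 1) * (1 + y) * z ^ (n - k)))"
      unfolding sum_distrib_left z_def by (intro sum.cong) (simp_all add: algebra_simps)
    finally show ?thesis
      by (simp add: poly_sum poly_monom z_def algebra_simps)
  qed
  then have "{0<..} \<subseteq> {y. poly (?lhs - ?rhs) y = 0}" by auto
  then have "infinite {y. poly (?lhs - ?rhs) y = 0}"
    using infinite_Ioi[of "0::real"] finite_subset by blast
  then show ?thesis using poly_roots_finite[of "?lhs - ?rhs"] by auto
qed

section \<open>The h-polynomial of the barycentric subdivision\<close>

theorem theorem3p2:
  fixes X :: "'a topology" and L :: "'a set set" and n :: nat
  assumes "cubical_complex X L"
    and "L - {{}} \<noteq> {}" and "complex_dim X L = n"
  shows "h_poly (sd L) {} = (\<Sum>k=0..n + 1. smult (cubical_h X L k) (pB n k))"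
proof -
  interpret cubical_family L "cell_dim X" n
    using cubical_family_complex[OF assms(1,2)] unfolding assms(3) .
  let ?h = "cubical_h X L"
  let ?m = "\<lambda>k. monom 1 (k - 1) * [:1, 1:] * [:2, 1:] ^ (n - k)"
  have dims: "cell_dim X ` (L - {{}}) \<subseteq> {0..n}"
  proof (rule image_subsetI)
    fix \<sigma> assume "\<sigma> \<in> L - {{}}"
    then show "cell_dim X \<sigma> \<in> {0..n}" using dim_le[of \<sigma>] by simp
  qed
  have "(\<Sum>\<sigma>\<in>L - {{}}. monom (1::real) (cell_dim X \<sigma>))
      = (\<Sum>k=0..n. \<Sum>\<sigma> | \<sigma> \<in> L - {{}} \<and> cell_dim X \<sigma> = k. monom 1 (cell_dim X \<sigma>))"
    using finite_family dims by (intro sum.group[symmetric]) auto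
  also have "\<dots> = (\<Sum>k=0..n. smult (real (f_num X L k)) (monom 1 k))"
  proof (rule sum.cong[OF refl])
    fix k
    have "(\<Sum>\<sigma> | \<sigma> \<in> L - {{}} \<and> cell_dim X \<sigma> = k. monom (1::real) (cell_dim X \<sigma>))
        = (\<Sum>\<sigma> | \<sigma> \<in> L - {{}} \<and> cell_dim X \<sigma> = k. monom 1 k)"
      by (rule sum.cong) simp_all
    also have "\<dots> = smult (real (f_num X L k)) (monom 1 k)"
      unfolding f_num_def by (simp add: of_nat_poly)
    finally show "(\<Sum>\<sigma> | \<sigma> \<in> L - {{}} \<and> cell_dim X \<sigma> = k. monom (1::real) (cell_dim X \<sigma>))
        = smult (real (f_num X L k)) (monom 1 k)" .
  qed
  finally have faces: "(\<Sum>\<sigma>\<in>L - {{}}. monom (1::real) (cell_dim X \<sigma>))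
      = [:2, 1:] ^ n + (\<Sum>k=1..n. smult (2 * ?h k) (?m k)) + smult (?h (n + 1)) (monom 1 n)"
    unfolding f_polynomial_eq[OF assms(3)] .
  have "h_poly (sd L) {} = [:1, - 1:] ^ (n + 1)
      + subdivided n (\<Sum>\<sigma>\<in>L - {{}}. monom 1 (cell_dim X \<sigma>))"
    unfolding h_poly_absolute using dims by (subst sum_top_chain_sum) auto
  also have "\<dots> = pB n 0 + (\<Sum>k=1..n. smult (?h k) (smult 2 (subdivided n (?m k))))
      + smult (?h (n + 1)) (pB n (n + 1))"
    unfolding faces pB_0 pB_top subdivided_add subdivided_sum subdivided_smult smult_smult
    by (simp only: mult.commute[of 2] add.assoc)
  also have "(\<Sum>k=1..n. smult (?h k) (smult 2 (subdivided n (?m k)))) = (\<Sum>k=1..n. smult (?h k) (pB n k))"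
    by (intro sum.cong refl) (simp only: pB_middle atLeastAtMost_iff)
  also have "pB n 0 + (\<Sum>k=1..n. smult (?h k) (pB n k)) + smult (?h (n + 1)) (pB n (n + 1))
      = (\<Sum>k=0..n + 1. smult (?h k) (pB n k))"
    by (simp add: sum.atLeast_Suc_atMost cubical_h_0)
  finally show ?thesis .
qed

end
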